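(* Let $0<n<\omega$. Suppose that $G$ is $\mathbb L$-generic or $\mathbb M$-generic over $V$. Then in $V[G]$, $|\mathfrak c^V|=|\mathfrak h(n)^V|$.
   Context: $\mathfrak c$ is the cardinality of the continuum. $(\mathcal P(\omega)/\mathrm{fin})^n$ is the $n$-fold product in the forcing sense (tuples of nonzero elements of $\mathcal P(\omega)/\mathrm{fin}$, ordered coordinatewise), and $\mathfrak h(n)$ is the least cardinal $\kappa$ such that $\mathrm{r.o.}((\mathcal P(\omega)/\mathrm{fin})^n)$ is not $\kappa$-distributive. For a tree $p\subseteq\omega^{<\omega}$ and $\eta\in p$ let $\mathrm{succ}_\eta(p)=\{k<\omega:\eta^\frown\langle k\rangle\in p\}$. The stem of $p$, if it exists, is the $\eta\in p$ with $|\mathrm{succ}_\eta(p)|\ge2$ and $|\mathrm{succ}_\nu(p)|=1$ for all $\nu\subsetneq\eta$. $p$ is a Laver tree if it has a stem and $\mathrm{succ}_\eta(p)$ is infinite for every $\eta\in p$ extending the stem. $p$ is superperfect if for every $\eta\in p$ there is $\nu\in p$ with $\eta\subseteq\nu$ and $\mathrm{succ}_\nu(p)$ infinite. Laver forcing $\mathbb L$ is the set of Laver trees, and Miller forcing $\mathbb M$ the set of superperfect trees, each ordered by reverse inclusion. *)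

theory Defs
  imports "HOL-Analysis.Analysis" "HOL-Library.Sublist"
begin

text \<open>
  A forcing notion is given by its order alone, a relation \<open>le\<close> that is reflexive on its
  field: the conditions are the elements of \<open>Field le\<close>, and \<open>(q, p) \<in> le\<close> says that \<open>q\<close> is
  stronger than \<open>p\<close>.
\<close>

section \<open>The algebra of regular open sets and its distributivity\<close>

definition poset_topology :: "'p rel \<Rightarrow> 'p topology" where
  "poset_topology le =
     topology (\<lambda>U. U \<subseteq> Field le \<and> (\<forall>p\<in>U. \<forall>q. (q, p) \<in> le \<longrightarrow> q \<in> U))"

definition regular_opens :: "'a topology \<Rightarrow> 'a set set" where
  "regular_opens X = {U. openin X U \<and> X interior_of (X closure_of U) = U}"

definition ro_Sup :: "'a topology \<Rightarrow> 'a set set \<Rightarrow> 'a set" where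
  "ro_Sup X \<U> = X interior_of (X closure_of (\<Union>\<U>))"

definition ro_Inf :: "'a topology \<Rightarrow> 'a set set \<Rightarrow> 'a set" where
  "ro_Inf X \<U> = X interior_of (topspace X \<inter> \<Inter>\<U>)"

text \<open>
  The complete distributive law for \<open>\<kappa>\<close> many families of arbitrary size. The sets of elements
  \<open>A \<alpha>\<close> play the role of the indexed families \<open>(u\<^bsub>\<alpha>,i\<^esub>)\<^bsub>i\<in>I\<^sub>\<alpha>\<^esub>\<close>.
\<close>

definition ro_distributive :: "'k rel \<Rightarrow> 'p rel \<Rightarrow> bool" where
  "ro_distributive \<kappa> le \<longleftrightarrow>
     (let X = poset_topology le; K = Field \<kappa> in
      \<forall>A. (\<forall>\<alpha>\<in>K. A \<alpha> \<subseteq> regular_opens X) \<longrightarrow>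
          ro_Inf X {ro_Sup X (A \<alpha>) | \<alpha>. \<alpha> \<in> K} =
          ro_Sup X {ro_Inf X (f ` K) | f. \<forall>\<alpha>\<in>K. f \<alpha> \<in> A \<alpha>})"

section \<open>Powers of \<open>P(\<omega>)/fin\<close> and the cardinals \<open>h(n)\<close>\<close>

definition eq_fin :: "nat set rel" where
  "eq_fin = {(A, B). finite ((A - B) \<union> (B - A))}"

definition P_fin :: "nat set set set" where
  "P_fin = UNIV // eq_fin"

definition P_fin_zero :: "nat set set" where
  "P_fin_zero = eq_fin `` {{}}"

definition P_fin_le :: "nat set set \<Rightarrow> nat set set \<Rightarrow> bool" where
  "P_fin_le a b \<longleftrightarrow> (\<exists>A\<in>a. \<exists>B\<in>b. finite (A - B))"

definition P_fin_power :: "nat \<Rightarrow> (nat \<Rightarrow> nat set set) rel" where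
  "P_fin_power n =
     {(a, b). a \<in> {..<n} \<rightarrow>\<^sub>E P_fin - {P_fin_zero} \<and> b \<in> {..<n} \<rightarrow>\<^sub>E P_fin - {P_fin_zero} \<and>
              (\<forall>i<n. P_fin_le (a i) (b i))}"

text \<open>
  Cardinals are cardinal well-orders in the sense of the library, hence determined only up to
  order isomorphism. Subsets of the type \<open>nat set\<close> realise all cardinals up to the continuum;
  lemma \<open>h_number\<close> below shows that the required least cardinal is among them.
\<close>

definition is_h_number :: "nat \<Rightarrow> 'k rel \<Rightarrow> bool" where
  "is_h_number n \<kappa> \<longleftrightarrow>
     Card_order \<kappa> \<and> \<not> ro_distributive \<kappa> (P_fin_power n) \<and>
     (\<forall>\<mu> :: 'k rel. Card_order \<mu> \<and> \<not> ro_distributive \<mu> (P_fin_power n) \<longrightarrow> (\<kappa>, \<mu>) \<in> ordLeq)"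

definition h_number :: "nat \<Rightarrow> nat set rel" where
  "h_number n = (SOME \<kappa>. is_h_number n \<kappa>)"

definition continuum :: "real rel" where
  "continuum = card_of (UNIV :: real set)"

section \<open>Laver and Miller forcing\<close>

definition is_tree :: "nat list set \<Rightarrow> bool" where
  "is_tree p \<longleftrightarrow> p \<noteq> {} \<and> (\<forall>\<eta>\<in>p. \<forall>\<nu>. prefix \<nu> \<eta> \<longrightarrow> \<nu> \<in> p)"

definition succs :: "nat list \<Rightarrow> nat list set \<Rightarrow> nat set" where
  "succs \<eta> p = {k. \<eta> @ [k] \<in> p}"

definition is_stem :: "nat list set \<Rightarrow> nat list \<Rightarrow> bool" where
  "is_stem p \<eta> \<longleftrightarrow> \<eta> \<in> p \<and> (infinite (succs \<eta> p) \<or> card (succs \<eta> p) \<ge> 2) \<and>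
     (\<forall>\<nu>. strict_prefix \<nu> \<eta> \<longrightarrow> card (succs \<nu> p) = 1)"

definition laver_tree :: "nat list set \<Rightarrow> bool" where
  "laver_tree p \<longleftrightarrow> is_tree p \<and>
     (\<exists>s. is_stem p s \<and> (\<forall>\<eta>\<in>p. prefix s \<eta> \<longrightarrow> infinite (succs \<eta> p)))"

definition superperfect_tree :: "nat list set \<Rightarrow> bool" where
  "superperfect_tree p \<longleftrightarrow> is_tree p \<and>
     (\<forall>\<eta>\<in>p. \<exists>\<nu>\<in>p. prefix \<eta> \<nu> \<and> infinite (succs \<nu> p))"

definition laver_forcing :: "nat list set rel" where
  "laver_forcing = {(q, p). laver_tree q \<and> laver_tree p \<and> q \<subseteq> p}"

definition miller_forcing :: "nat list set rel" where
  "miller_forcing = {(q, p). superperfect_tree q \<and> superperfect_tree p \<and> q \<subseteq> p}"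

section \<open>The forcing relation\<close>

text \<open>
  A sentence of the forcing language is represented by the set of conditions that force it, as a
  predicate on conditions; the connectives below are the clauses of the usual recursive definition
  of the forcing relation. Quantifiers range over ground model sets (standing for their check
  names) and over names for subsets of ground model sets. A name for a subset of the ground model
  set \<open>X\<close> is a set of pairs \<open>(x, p)\<close> with \<open>x \<in> X\<close> and \<open>p\<close> a condition; its value under a generic
  filter \<open>G\<close> is \<open>{x. \<exists>p\<in>G. (x, p) \<in> \<tau>}\<close>. Every subset of \<open>X\<close> in a generic extension is the
  value of such a name.
\<close>

type_synonym 'p sentence = "'p \<Rightarrow> bool"
type_synonym ('x, 'p) name = "('x \<times> 'p) set"

definition dense_below :: "'p rel \<Rightarrow> 'p set \<Rightarrow> 'p \<Rightarrow> bool" where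
  "dense_below le D p \<longleftrightarrow> (\<forall>q. (q, p) \<in> le \<longrightarrow> (\<exists>r\<in>D. (r, q) \<in> le))"

definition names :: "'p rel \<Rightarrow> 'x set \<Rightarrow> ('x, 'p) name set" where
  "names le X = Pow (X \<times> Field le)"

definition f_mem :: "'p rel \<Rightarrow> 'x \<Rightarrow> ('x, 'p) name \<Rightarrow> 'p sentence" where
  "f_mem le x \<tau> p \<longleftrightarrow> dense_below le {q. \<exists>r. (x, r) \<in> \<tau> \<and> (q, r) \<in> le} p"

definition f_check_eq :: "'x \<Rightarrow> 'x \<Rightarrow> 'p sentence" where
  "f_check_eq x y p \<longleftrightarrow> x = y"

definition f_conj :: "'p sentence \<Rightarrow> 'p sentence \<Rightarrow> 'p sentence" where
  "f_conj \<phi> \<psi> p \<longleftrightarrow> \<phi> p \<and> \<psi> p"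

definition f_neg :: "'p rel \<Rightarrow> 'p sentence \<Rightarrow> 'p sentence" where
  "f_neg le \<phi> p \<longleftrightarrow> (\<forall>q. (q, p) \<in> le \<longrightarrow> \<not> \<phi> q)"

definition f_imp :: "'p rel \<Rightarrow> 'p sentence \<Rightarrow> 'p sentence \<Rightarrow> 'p sentence" where
  "f_imp le \<phi> \<psi> = f_neg le (f_conj \<phi> (f_neg le \<psi>))"

definition f_all :: "'x set \<Rightarrow> ('x \<Rightarrow> 'p sentence) \<Rightarrow> 'p sentence" where
  "f_all S \<phi> p \<longleftrightarrow> (\<forall>x\<in>S. \<phi> x p)"

definition f_ex :: "'p rel \<Rightarrow> 'x set \<Rightarrow> ('x \<Rightarrow> 'p sentence) \<Rightarrow> 'p sentence" where
  "f_ex le S \<phi> p \<longleftrightarrow> dense_below le {q. \<exists>x\<in>S. \<phi> x q} p"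

definition f_function :: "'p rel \<Rightarrow> 'a set \<Rightarrow> 'b set \<Rightarrow> ('a \<times> 'b, 'p) name \<Rightarrow> 'p sentence" where
  "f_function le A B \<tau> =
     f_conj
       (f_all A (\<lambda>x. f_ex le B (\<lambda>y. f_mem le (x, y) \<tau>)))
       (f_all A (\<lambda>x. f_all B (\<lambda>y. f_all B (\<lambda>z.
          f_imp le (f_conj (f_mem le (x, y) \<tau>) (f_mem le (x, z) \<tau>)) (f_check_eq y z)))))"

definition f_injective :: "'p rel \<Rightarrow> 'a set \<Rightarrow> 'b set \<Rightarrow> ('a \<times> 'b, 'p) name \<Rightarrow> 'p sentence" where
  "f_injective le A B \<tau> =
     f_all A (\<lambda>x. f_all A (\<lambda>w. f_all B (\<lambda>y.
       f_imp le (f_conj (f_mem le (x, y) \<tau>) (f_mem le (w, y) \<tau>)) (f_check_eq x w))))"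

definition f_surjective :: "'p rel \<Rightarrow> 'a set \<Rightarrow> 'b set \<Rightarrow> ('a \<times> 'b, 'p) name \<Rightarrow> 'p sentence" where
  "f_surjective le A B \<tau> = f_all B (\<lambda>y. f_ex le A (\<lambda>x. f_mem le (x, y) \<tau>))"

text \<open>
  The sentence \<open>|\<kappa>| = |\<mu>|\<close>, for ground model cardinals \<open>\<kappa>\<close> and \<open>\<mu>\<close>: there is a bijection
  between their underlying sets.
\<close>

definition f_same_card :: "'p rel \<Rightarrow> 'a rel \<Rightarrow> 'b rel \<Rightarrow> 'p sentence" where
  "f_same_card le \<kappa> \<mu> =
     f_ex le (names le (Field \<kappa> \<times> Field \<mu>)) (\<lambda>\<tau>.
       f_conj (f_function le (Field \<kappa>) (Field \<mu>) \<tau>)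
         (f_conj (f_injective le (Field \<kappa>) (Field \<mu>) \<tau>)
                 (f_surjective le (Field \<kappa>) (Field \<mu>) \<tau>)))"

text \<open>
  A sentence holds in \<open>V[G]\<close> for every \<open>G\<close> that is generic over \<open>V\<close> iff every condition forces
  it.
\<close>

definition holds_in_generic_extensions :: "'p rel \<Rightarrow> 'p sentence \<Rightarrow> bool" where
  "holds_in_generic_extensions le \<phi> \<longleftrightarrow> (\<forall>p\<in>Field le. \<phi> p)"

section \<open>The cardinal \<open>h(n)\<close> is well defined\<close>

lemma openin_poset_topology:
  "openin (poset_topology le) U \<longleftrightarrow>
     U \<subseteq> Field le \<and> (\<forall>p\<in>U. \<forall>q. (q, p) \<in> le \<longrightarrow> q \<in> U)"
proof -
  have "istopology (\<lambda>U. U \<subseteq> Field le \<and> (\<forall>p\<in>U. \<forall>q. (q, p) \<in> le \<longrightarrow> q \<in> U))"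
    unfolding istopology_def by blast
  then show ?thesis
    unfolding poset_topology_def by (simp add: topology_inverse')
qed

lemma topspace_poset_topology: "topspace (poset_topology le) = Field le"
proof -
  have "openin (poset_topology le) (Field le)"
    by (auto simp: openin_poset_topology Field_def)
  then show ?thesis
    by (metis openin_poset_topology openin_subset openin_topspace subset_antisym)
qed

lemma interior_closure_poset_topology:
  assumes "refl_on (Field le) le" "trans le"
  shows "poset_topology le interior_of (poset_topology le closure_of U) =
         {p \<in> Field le. dense_below le U p}"
proof -
  let ?X = "poset_topology le"
  have below: "openin ?X {r. (r, q) \<in> le}" for q
    unfolding openin_poset_topology using assms(2) by (auto simp: Field_def dest: transD)
  have cl: "?X closure_of U = {q \<in> Field le. \<exists>u\<in>U. (u, q) \<in> le}" (is "_ = ?C")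
  proof (intro set_eqI iffI)
    fix q assume q: "q \<in> ?X closure_of U"
    then have "q \<in> Field le"
      by (simp add: in_closure_of topspace_poset_topology)
    moreover from this have "(q, q) \<in> le"
      using assms(1) by (auto dest: refl_onD)
    ultimately have "\<exists>u. u \<in> U \<and> u \<in> {r. (r, q) \<in> le}"
      using q below[of q] by (simp only: in_closure_of) (metis mem_Collect_eq)
    then show "q \<in> ?C" using \<open>q \<in> Field le\<close> by blast
  next
    fix q assume "q \<in> ?C"
    then show "q \<in> ?X closure_of U"
      unfolding in_closure_of topspace_poset_topology openin_poset_topology by blast
  qed
  show ?thesis
  proof (intro set_eqI iffI)
    fix p assume "p \<in> ?X interior_of (?X closure_of U)"
    then obtain T where T: "openin ?X T" "T \<subseteq> ?C" "p \<in> T"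
      unfolding interior_of_def cl by blast
    then have "q \<in> ?C" if "(q, p) \<in> le" for q
      using that unfolding openin_poset_topology by blast
    then show "p \<in> {p \<in> Field le. dense_below le U p}"
      using T by (auto simp: dense_below_def)
  next
    fix p assume "p \<in> {p \<in> Field le. dense_below le U p}"
    then have p: "p \<in> Field le" "dense_below le U p" by auto
    have "{q. (q, p) \<in> le} \<subseteq> ?C"
      using p(2) by (auto simp: dense_below_def Field_def)
    moreover have "(p, p) \<in> le" using p(1) assms(1) by (auto dest: refl_onD)
    ultimately show "p \<in> ?X interior_of (?X closure_of U)"
      using below[of p] unfolding interior_of_def cl by blast
  qed
qed

lemma equiv_eq_fin: "equiv UNIV eq_fin"
proof (rule equivI)
  show "eq_fin \<subseteq> UNIV \<times> UNIV" by simp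
  show "refl_on UNIV eq_fin" by (auto simp: eq_fin_def refl_on_def)
  show "sym eq_fin" by (auto simp: eq_fin_def sym_def)
  show "trans eq_fin"
  proof (rule transI)
    fix A B C assume "(A, B) \<in> eq_fin" "(B, C) \<in> eq_fin"
    then have "finite (((A - B) \<union> (B - A)) \<union> ((B - C) \<union> (C - B)))"
      by (simp add: eq_fin_def)
    then have "finite ((A - C) \<union> (C - A))" by (rule rev_finite_subset) blast
    then show "(A, C) \<in> eq_fin" by (simp add: eq_fin_def)
  qed
qed

lemma P_fin_le_class: "P_fin_le (eq_fin `` {A}) (eq_fin `` {B}) \<longleftrightarrow> finite (A - B)"
proof
  assume "P_fin_le (eq_fin `` {A}) (eq_fin `` {B})"
  then obtain C D where "(A, C) \<in> eq_fin" "(B, D) \<in> eq_fin" "finite (C - D)"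
    unfolding P_fin_le_def by auto
  then have "finite ((A - C) \<union> (C - D) \<union> (D - B))"
    by (simp add: eq_fin_def)
  then show "finite (A - B)" by (rule rev_finite_subset) auto
next
  assume "finite (A - B)"
  then show "P_fin_le (eq_fin `` {A}) (eq_fin `` {B})"
    unfolding P_fin_le_def
    by (meson ImageI UNIV_I equiv_class_self equiv_eq_fin)
qed

lemma P_fin_nonzero: "a \<in> P_fin - {P_fin_zero} \<longleftrightarrow> (\<exists>A. infinite A \<and> a = eq_fin `` {A})"
proof -
  have "eq_fin `` {A} = P_fin_zero \<longleftrightarrow> finite A" for A
    unfolding P_fin_zero_def eq_equiv_class_iff[OF equiv_eq_fin UNIV_I UNIV_I]
    by (simp add: eq_fin_def)
  then show ?thesis
    unfolding P_fin_def quotient_def by blast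
qed

lemma P_fin_power_refl':
  assumes a: "a \<in> {..<n} \<rightarrow>\<^sub>E P_fin - {P_fin_zero}"
  shows "(a, a) \<in> P_fin_power n"
proof -
  have "P_fin_le (a i) (a i)" if "i < n" for i
  proof -
    have "a i \<in> P_fin - {P_fin_zero}" using PiE_mem[OF a] that by simp
    then obtain A where "a i = eq_fin `` {A}" unfolding P_fin_nonzero by blast
    then show ?thesis by (simp add: P_fin_le_class)
  qed
  then show ?thesis using a by (simp add: P_fin_power_def)
qed

lemma P_fin_power_Field: "Field (P_fin_power n) = ({..<n} \<rightarrow>\<^sub>E P_fin - {P_fin_zero})"
proof
  show "Field (P_fin_power n) \<subseteq> ({..<n} \<rightarrow>\<^sub>E P_fin - {P_fin_zero})"
    by (auto simp: Field_def P_fin_power_def)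
  show "({..<n} \<rightarrow>\<^sub>E P_fin - {P_fin_zero}) \<subseteq> Field (P_fin_power n)"
    using P_fin_power_refl' by (blast intro: FieldI1)
qed

lemma P_fin_power_refl: "refl_on (Field (P_fin_power n)) (P_fin_power n)"
  by (rule refl_onI) (simp add: P_fin_power_Field P_fin_power_refl')

lemma P_fin_le_trans:
  assumes "a \<in> P_fin - {P_fin_zero}" "b \<in> P_fin - {P_fin_zero}" "c \<in> P_fin - {P_fin_zero}"
    and "P_fin_le a b" "P_fin_le b c"
  shows "P_fin_le a c"
proof -
  obtain A B C where *: "a = eq_fin `` {A}" "b = eq_fin `` {B}" "c = eq_fin `` {C}"
    using assms(1-3) unfolding P_fin_nonzero by blast
  then have "finite ((A - B) \<union> (B - C))" using assms(4,5) by (simp add: P_fin_le_class)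
  then have "finite (A - C)" by (rule rev_finite_subset) auto
  then show ?thesis by (simp add: * P_fin_le_class)
qed

lemma P_fin_power_trans: "trans (P_fin_power n)"
proof (rule transI)
  fix a b c assume ab: "(a, b) \<in> P_fin_power n" and bc: "(b, c) \<in> P_fin_power n"
  have "P_fin_le (a i) (c i)" if "i < n" for i
  proof (rule P_fin_le_trans[of _ "b i"])
    have "x i \<in> P_fin - {P_fin_zero}" if "x \<in> {..<n} \<rightarrow>\<^sub>E P_fin - {P_fin_zero}" for x
      using PiE_mem[OF that] \<open>i < n\<close> by simp
    then show "a i \<in> P_fin - {P_fin_zero}" "b i \<in> P_fin - {P_fin_zero}"
      "c i \<in> P_fin - {P_fin_zero}"
      using ab bc by (simp_all add: P_fin_power_def)
  qed (use ab bc that in \<open>simp_all add: P_fin_power_def\<close>)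
  then show "(a, c) \<in> P_fin_power n" using ab bc by (auto simp: P_fin_power_def)
qed

lemma P_fin_power_shrink:
  assumes a: "a \<in> Field (P_fin_power n)" and "0 < n" "a 0 = eq_fin `` {R}"
    and S: "S \<subseteq> R" "infinite S"
  shows "(a(0 := eq_fin `` {S}), a) \<in> P_fin_power n"
proof -
  have aa: "(a, a) \<in> P_fin_power n" using a P_fin_power_refl by (rule refl_onD[rotated])
  have "eq_fin `` {S} \<in> P_fin - {P_fin_zero}" using S unfolding P_fin_nonzero by blast
  moreover have "P_fin_le (eq_fin `` {S}) (a 0)"
    using S by (simp add: assms(3) P_fin_le_class Diff_eq_empty_iff[THEN iffD2])
  ultimately show ?thesis
    using aa \<open>0 < n\<close> unfolding P_fin_power_def by (auto simp: PiE_iff extensional_def)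
qed

lemma infinite_split:
  assumes "infinite (R :: nat set)"
  shows "\<exists>X. infinite (R \<inter> X) \<and> infinite (R - X)"
proof -
  let ?e = "enumerate R"
  have inj: "inj ?e" using assms by (simp add: inj_enumerate)
  have R: "range ?e = R" using assms by (rule range_enumerate)
  let ?X = "?e ` {k. even k}"
  have ev: "infinite {k::nat. even k}" "infinite {k::nat. odd k}"
  proof -
    have "\<exists>k\<ge>m. even k" "\<exists>k\<ge>m. odd k" for m :: nat
      by (rule exI[of _ "2 * m"], simp, rule exI[of _ "Suc (2 * m)"], simp)
    then show "infinite {k::nat. even k}" "infinite {k::nat. odd k}"
      unfolding infinite_nat_iff_unbounded_le by simp_all
  qed
  have "R \<inter> ?X = ?X" using R by blast
  moreover have "?e ` {k. odd k} \<subseteq> R - ?X" using R inj by (auto dest: injD)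
  moreover have "infinite ?X" "infinite (?e ` {k. odd k})"
    using ev inj by (metis finite_imageD inj_on_subset subset_UNIV)+
  ultimately show ?thesis by (metis finite_subset)
qed

lemma not_ro_distributive_continuum:
  assumes n: "0 < n"
  shows "\<not> ro_distributive (card_of (UNIV :: nat set set)) (P_fin_power n)"
proof
  assume distr: "ro_distributive (card_of (UNIV :: nat set set)) (P_fin_power n)"
  let ?le = "P_fin_power n"
  let ?X = "poset_topology ?le"
  let ?F = "Field ?le"
  define U where "U B = {a \<in> ?F. P_fin_le (a 0) (eq_fin `` {B})}" for B
  define A where "A B = {U B, U (- B)}" for B
  note ic = interior_closure_poset_topology[OF P_fin_power_refl P_fin_power_trans]
  have zero: "\<exists>R. infinite R \<and> a 0 = eq_fin `` {R}" if "a \<in> ?F" for a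
    using PiE_mem[of a "{..<n}" "\<lambda>_. P_fin - {P_fin_zero}" 0] that n
    by (simp only: P_fin_power_Field P_fin_nonzero lessThan_iff)
  have le0: "P_fin_le (a 0) (b 0)" if "(a, b) \<in> ?le" for a b
    using that n by (simp add: P_fin_power_def)
  have inF: "a \<in> ?F" "b \<in> ?F" if "(a, b) \<in> ?le" for a b
    using that by (auto simp: Field_def)
  have openU: "openin ?X (U B)" for B
    unfolding openin_poset_topology
  proof (intro conjI ballI allI impI)
    show "U B \<subseteq> ?F" by (auto simp: U_def)
    fix p q assume p: "p \<in> U B" and qp: "(q, p) \<in> ?le"
    obtain R S where "p 0 = eq_fin `` {R}" "q 0 = eq_fin `` {S}"
      using zero inF[OF qp] by blast
    then have "finite ((S - R) \<union> (R - B))"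
      using p le0[OF qp] by (simp add: U_def P_fin_le_class)
    then have "finite (S - B)" by (rule rev_finite_subset) auto
    then show "q \<in> U B"
      using inF[OF qp] \<open>q 0 = _\<close> by (simp add: U_def P_fin_le_class)
  qed
  have "p \<in> U B" if p: "p \<in> ?F" and dense: "dense_below ?le (U B) p" for p B
  proof (rule ccontr)
    assume "p \<notin> U B"
    obtain R where R: "infinite R" "p 0 = eq_fin `` {R}" using zero p by blast
    then have "infinite (R - B)" using \<open>p \<notin> U B\<close> p by (simp add: U_def P_fin_le_class)
    then have q: "(p(0 := eq_fin `` {R - B}), p) \<in> ?le"
      using P_fin_power_shrink[OF p n R(2)] by blast
    then obtain r where r: "r \<in> U B" "(r, p(0 := eq_fin `` {R - B})) \<in> ?le"
      using dense unfolding dense_below_def by blast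
    obtain S where S: "infinite S" "r 0 = eq_fin `` {S}" using zero inF r by blast
    have "finite (S - (R - B))" using le0[OF r(2)] S by (simp add: P_fin_le_class)
    moreover have "finite (S - B)" using r(1) S by (simp add: U_def P_fin_le_class)
    ultimately have "finite ((S - (R - B)) \<union> (S - B))" by simp
    then have "finite S" by (rule rev_finite_subset) auto
    then show False using S by simp
  qed
  moreover have "dense_below ?le (U B) p" if "p \<in> U B" for p B
    using openU[of B] that P_fin_power_refl[of n]
    unfolding dense_below_def openin_poset_topology by (meson refl_onD subsetD)
  ultimately have "{p \<in> ?F. dense_below ?le (U B) p} = U B" for B
    unfolding U_def by blast
  then have "U B \<in> regular_opens ?X" for B
    using openU by (simp add: regular_opens_def ic)
  then have A: "A B \<subseteq> regular_opens ?X" for B by (simp add: A_def)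
  have sup: "ro_Sup ?X (A B) = ?F" for B
  proof -
    have "dense_below ?le (U B \<union> U (- B)) p" for p
      unfolding dense_below_def
    proof (intro allI impI)
      fix q assume "(q, p) \<in> ?le"
      then have q: "q \<in> ?F" by (rule inF)
      then obtain R where R: "infinite R" "q 0 = eq_fin `` {R}" using zero by blast
      have "\<exists>C\<in>{B, - B}. infinite (R \<inter> C)"
      proof (rule ccontr)
        assume "\<not> ?thesis"
        then have "finite ((R \<inter> B) \<union> (R \<inter> - B))" by simp
        then have "finite R" by (rule rev_finite_subset) auto
        then show False using R(1) by simp
      qed
      then obtain C where C: "C \<in> {B, - B}" "infinite (R \<inter> C)" by blast
      let ?r = "q(0 := eq_fin `` {R \<inter> C})"
      have "(?r, q) \<in> ?le" using P_fin_power_shrink[OF q n R(2) _ C(2)] by blast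
      moreover from this have "?r \<in> U C"
        using inF by (auto simp: U_def P_fin_le_class Diff_eq_empty_iff[THEN iffD2])
      ultimately show "\<exists>r\<in>U B \<union> U (- B). (r, q) \<in> ?le" using C(1) by blast
    qed
    moreover have "\<Union>(A B) = U B \<union> U (- B)" by (simp add: A_def)
    ultimately show ?thesis by (simp only: ro_Sup_def ic) simp
  qed
  have inf: "ro_Inf ?X (f ` UNIV) = {}" if f: "\<And>B. f B \<in> A B" for f
  proof (rule ccontr)
    assume "ro_Inf ?X (f ` UNIV) \<noteq> {}"
    then obtain p where p: "p \<in> ro_Inf ?X (f ` UNIV)" by blast
    then have "p \<in> topspace ?X \<inter> \<Inter>(f ` UNIV)"
      unfolding ro_Inf_def by (rule subsetD[OF interior_of_subset])
    then have pf: "p \<in> ?F" "p \<in> f B" for B by (auto simp: topspace_poset_topology)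
    obtain R where R: "infinite R" "p 0 = eq_fin `` {R}" using zero pf(1) by blast
    obtain B where B: "infinite (R \<inter> B)" "infinite (R - B)"
      using infinite_split[OF R(1)] by blast
    have "p \<in> U B \<or> p \<in> U (- B)" using f[of B] pf(2)[of B] by (auto simp: A_def)
    then show False using B R by (auto simp: U_def P_fin_le_class Diff_Compl)
  qed
  have nonempty: "?F \<noteq> {}"
    using P_fin_nonzero[of "eq_fin `` {UNIV}"]
    by (auto simp: P_fin_power_Field PiE_eq_empty_iff)
  have "ro_Inf ?X {ro_Sup ?X (A \<alpha>) | \<alpha>. \<alpha> \<in> UNIV} = ?F"
  proof -
    have "{ro_Sup ?X (A \<alpha>) | \<alpha>. \<alpha> \<in> UNIV} = {topspace ?X}"
      by (auto simp: sup topspace_poset_topology)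
    then show ?thesis by (simp add: ro_Inf_def topspace_poset_topology[symmetric])
  qed
  moreover have "ro_Sup ?X {ro_Inf ?X (f ` UNIV) | f. \<forall>\<alpha>\<in>UNIV. f \<alpha> \<in> A \<alpha>} = {}"
  proof -
    have "\<Union>{ro_Inf ?X (f ` UNIV) | f. \<forall>\<alpha>\<in>UNIV. f \<alpha> \<in> A \<alpha>} = {}" using inf by auto
    then show ?thesis by (simp only: ro_Sup_def closure_of_empty interior_of_empty)
  qed
  moreover have "ro_Inf ?X {ro_Sup ?X (A \<alpha>) | \<alpha>. \<alpha> \<in> UNIV} =
      ro_Sup ?X {ro_Inf ?X (f ` UNIV) | f. \<forall>\<alpha>\<in>UNIV. f \<alpha> \<in> A \<alpha>}"
    using distr[unfolded ro_distributive_def Let_def Field_card_of, rule_format, of A] A by simp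
  ultimately show False using nonempty by simp
qed

lemma h_number:
  assumes "0 < n"
  shows "is_h_number n (h_number n)"
proof -
  let ?R = "{\<mu> :: nat set rel. Card_order \<mu> \<and> \<not> ro_distributive \<mu> (P_fin_power n)}"
  have "card_of (UNIV :: nat set set) \<in> ?R"
    using not_ro_distributive_continuum[OF assms] card_of_Card_order by blast
  then obtain \<kappa> where "\<kappa> \<in> ?R" "\<forall>\<mu>\<in>?R. (\<kappa>, \<mu>) \<in> ordLeq"
    using exists_minim_Card_order[of ?R] by blast
  then have "is_h_number n \<kappa>" by (simp add: is_h_number_def)
  then show ?thesis unfolding h_number_def by (rule someI)
qed

end

theory Submission
  imports Defs
begin

unbundle cardinal_syntax

text \<open>
  Let \<open>\<kappa> = h(n)\<close>. Non-distributivity and the minimality of \<open>\<kappa>\<close> yield antichains \<open>B\<^sub>\<beta>\<close>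
  (\<open>\<beta> < \<kappa>\<close>) of \<open>(P(\<omega>)/fin)\<^sup>n\<close> such that no condition lies below a member of every \<open>B\<^sub>\<beta>\<close>, while for
  every \<open>\<alpha> < \<kappa>\<close> the conditions that lie below members of all \<open>B\<^sub>\<beta>\<close>, \<open>\<beta> \<le> \<alpha>\<close>, are dense; such a
  condition has a code on level \<open>\<alpha>\<close>, the branch through these antichains above it, and conditions
  with different codes are incompatible. As \<open>P(\<omega>)/fin\<close> is \<open>\<sigma>\<close>-closed, \<open>\<kappa>\<close> has uncountable cofinality.

  The successor sets of a Laver or superperfect tree \<open>p\<close> form a countable family of infinite sets.
  Splitting it along the antichains in a binary tree of height \<open>\<omega>\<close> produces a level \<open>\<alpha>\<close> and
  continuum many thinnings of \<open>p\<close> such that, for each \<open>n\<close>-tuple of distinct nodes, the successor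
  sets at these nodes have pairwise different codes on level \<open>\<alpha>\<close>. There are only continuum many
  pairs of a tree and a real, so a transfinite recursion assigns to each pair \<open>(p, x)\<close> a thinning
  of \<open>p\<close> in such a way that thinnings of the same level are incompatible. Mapping \<open>\<alpha>\<close> to the
  real \<open>x\<close> that belongs to the chosen thinning of level \<open>\<alpha>\<close> in the generic filter is a partial
  surjection from \<open>\<kappa>\<close> onto the ground model reals.
\<close>

section \<open>Names for bijections\<close>

text \<open>The name \<open>\<tau>\<close> puts the pair (x, y) at every condition \<open>q\<close>
  with \<open>H q x y\<close>. By \<open>mono\<close> such a \<open>q\<close> forces membership.
  Conversely, forced membership only gives \<open>H r x y\<close> for some \<open>r\<close> below;
  this suffices because functionality and injectivity are assumed at all conditions.\<close>

lemma f_same_cardI: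
  fixes H :: "'p \<Rightarrow> 'a \<Rightarrow> 'b \<Rightarrow> bool"
  assumes refl: "refl_on (Field le) le" and trans: "trans le"
    and mono: "\<And>q r x y. H q x y \<Longrightarrow> (r, q) \<in> le \<Longrightarrow> H r x y"
    and functional: "\<And>q x y z. q \<in> Field le \<Longrightarrow> H q x y \<Longrightarrow> H q x z \<Longrightarrow> y = z"
    and injective: "\<And>q x y z. q \<in> Field le \<Longrightarrow> H q x z \<Longrightarrow> H q y z \<Longrightarrow> x = y"
    and total: "\<And>p x. p \<in> Field le \<Longrightarrow> x \<in> Field \<kappa> \<Longrightarrow> \<exists>q y. (q, p) \<in> le \<and> y \<in> Field \<mu> \<and> H q x y"
    and surjective: "\<And>p y. p \<in> Field le \<Longrightarrow> y \<in> Field \<mu> \<Longrightarrow> \<exists>q x. (q, p) \<in> le \<and> x \<in> Field \<kappa> \<and> H q x y"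
  shows "holds_in_generic_extensions le (f_same_card le \<kappa> \<mu>)"
proof -
  define \<tau> where "\<tau> = {((x, y), q). x \<in> Field \<kappa> \<and> y \<in> Field \<mu> \<and> q \<in> Field le \<and> H q x y}"
  have le_refl: "(p, p) \<in> le" if "p \<in> Field le" for p
    using refl that by (auto dest: refl_onD)
  have inF: "q \<in> Field le" "p \<in> Field le" if "(q, p) \<in> le" for p q
    using that by (auto simp: Field_def)
  have names: "\<tau> \<in> names le (Field \<kappa> \<times> Field \<mu>)"
    by (auto simp: names_def \<tau>_def)
  have memI: "f_mem le (x, y) \<tau> q" if "H q x y" "q \<in> Field le" "x \<in> Field \<kappa>" "y \<in> Field \<mu>" for q x y
    unfolding f_mem_def dense_below_def
  proof (intro allI impI)
    fix r assume "(r, q) \<in> le"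
    then have "r \<in> {s. \<exists>t. ((x, y), t) \<in> \<tau> \<and> (s, t) \<in> le}"
      using that by (auto simp: \<tau>_def)
    then show "\<exists>s\<in>{s. \<exists>t. ((x, y), t) \<in> \<tau> \<and> (s, t) \<in> le}. (s, r) \<in> le"
      using le_refl[OF inF(1)[OF \<open>(r, q) \<in> le\<close>]] by blast
  qed
  have memD: "\<exists>r. (r, q) \<in> le \<and> H r x y" if "f_mem le (x, y) \<tau> q" "q \<in> Field le" for q x y
    using that le_refl[of q] mono unfolding f_mem_def dense_below_def \<tau>_def by blast
  have mem_mono: "f_mem le z \<tau> r" if "f_mem le z \<tau> q" "(r, q) \<in> le" for z q r
    using that transD[OF trans] unfolding f_mem_def dense_below_def by blast
  \<comment> \<open>Realise the first membership below \<open>q\<close>, pass the second down to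
    that condition and realise it there; \<open>mono\<close> keeps the first.\<close>
  have both: "\<exists>r\<in>Field le. H r x y \<and> H r x' y'"
    if "f_mem le (x, y) \<tau> q" "f_mem le (x', y') \<tau> q" "q \<in> Field le" for q x y x' y'
    using memD[OF that(1,3)] memD mem_mono[OF that(2)] mono inF by metis
  have "f_function le (Field \<kappa>) (Field \<mu>) \<tau> p" if "p \<in> Field le" for p
    unfolding f_function_def f_conj_def f_all_def
  proof (intro conjI ballI)
    fix x assume x: "x \<in> Field \<kappa>"
    show "f_ex le (Field \<mu>) (\<lambda>y. f_mem le (x, y) \<tau>) p"
      unfolding f_ex_def dense_below_def
    proof (intro allI impI)
      fix q assume "(q, p) \<in> le"
      then obtain r y where r: "(r, q) \<in> le" "y \<in> Field \<mu>" "H r x y"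
        using total[OF inF(1) x] by blast
      then have "f_mem le (x, y) \<tau> r" using memI inF x by blast
      then show "\<exists>r\<in>{r. \<exists>y\<in>Field \<mu>. f_mem le (x, y) \<tau> r}. (r, q) \<in> le" using r by blast
    qed
  next
    fix x y z
    show "f_imp le (\<lambda>p. f_mem le (x, y) \<tau> p \<and> f_mem le (x, z) \<tau> p) (f_check_eq y z) p"
      unfolding f_imp_def f_neg_def f_conj_def f_check_eq_def
      using both functional inF le_refl by metis
  qed
  moreover have "f_injective le (Field \<kappa>) (Field \<mu>) \<tau> p" if "p \<in> Field le" for p
    unfolding f_injective_def f_imp_def f_neg_def f_conj_def f_check_eq_def f_all_def
    using both injective inF le_refl by metis
  moreover have "f_surjective le (Field \<kappa>) (Field \<mu>) \<tau> p" if "p \<in> Field le" for p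
    unfolding f_surjective_def f_all_def f_ex_def dense_below_def
  proof (intro ballI allI impI)
    fix y q assume y: "y \<in> Field \<mu>" and "(q, p) \<in> le"
    then obtain r x where r: "(r, q) \<in> le" "x \<in> Field \<kappa>" "H r x y"
      using surjective[OF inF(1) y] by blast
    then have "f_mem le (x, y) \<tau> r" using memI inF y by blast
    then show "\<exists>r\<in>{r. \<exists>x\<in>Field \<kappa>. f_mem le (x, y) \<tau> r}. (r, q) \<in> le" using r by blast
  qed
  ultimately show ?thesis
    unfolding holds_in_generic_extensions_def f_same_card_def f_ex_def dense_below_def f_conj_def
    using names inF le_refl by blast
qed

text \<open>
  The Schroeder-Bernstein argument inside the extension: identify \<open>A\<close> with \<open>A + B \<times> \<omega>\<close> and
  \<open>B\<close> with \<open>B \<times> \<omega>\<close> in the ground model. If \<open>M \<subseteq> B\<close> is the range of the forced injection \<open>v\<close>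
  then \<open>x \<mapsto> (v x, 0)\<close> together with the shift \<open>(\<alpha>, i) \<mapsto> (\<alpha>, i + 1)\<close> for \<open>\<alpha> \<in> M\<close>, and the
  identity for \<open>\<alpha> \<notin> M\<close>, is a bijection.
\<close>

lemma f_same_card_if_injection:
  fixes \<kappa> :: "'a rel" and \<mu> :: "'b rel" and V :: "'p \<Rightarrow> 'a \<Rightarrow> 'b \<Rightarrow> bool"
  assumes refl: "refl_on (Field le) le" and trans: "trans le"
    and inf: "infinite (Field \<mu>)" and small: "|Field \<mu>| \<le>o |Field \<kappa>|"
    and mono: "\<And>q r x y. V q x y \<Longrightarrow> (r, q) \<in> le \<Longrightarrow> V r x y"
    and functional: "\<And>q x y z. q \<in> Field le \<Longrightarrow> V q x y \<Longrightarrow> V q x z \<Longrightarrow> y = z"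
    and injective: "\<And>q x y z. q \<in> Field le \<Longrightarrow> V q x z \<Longrightarrow> V q y z \<Longrightarrow> x = y"
    and total: "\<And>p x. p \<in> Field le \<Longrightarrow> x \<in> Field \<kappa> \<Longrightarrow> \<exists>q y. (q, p) \<in> le \<and> y \<in> Field \<mu> \<and> V q x y"
  shows "holds_in_generic_extensions le (f_same_card le \<kappa> \<mu>)"
proof -
  let ?A = "Field \<kappa>" and ?B = "Field \<mu>"
  have le_refl: "(p, p) \<in> le" if "p \<in> Field le" for p
    using refl that by (auto dest: refl_onD)
  have natB: "|UNIV :: nat set| \<le>o |?B|"
    using inf infinite_iff_card_of_nat by blast
  have BN: "|?B \<times> (UNIV :: nat set)| =o |?B|"
    using card_of_Times_infinite[OF inf _ natB] by blast
  then obtain g where g: "bij_betw g ?B (?B \<times> (UNIV :: nat set))"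
    using card_of_ordIso ordIso_symmetric by blast
  have "infinite ?A" using inf small card_of_ordLeq_infinite by blast
  moreover have "|?B \<times> (UNIV :: nat set)| \<le>o |?A|"
    using BN small ordIso_ordLeq_trans by blast
  ultimately have "|?A <+> ?B \<times> (UNIV :: nat set)| =o |?A|"
    using card_of_Plus_infinite1 by blast
  then obtain f where f: "bij_betw f ?A (?A <+> ?B \<times> (UNIV :: nat set))"
    using card_of_ordIso ordIso_symmetric by blast
  \<comment> \<open>\<open>M q \<alpha>\<close> says that \<open>q\<close> already exhibits a
    preimage of \<open>\<alpha>\<close>, \<open>N q \<alpha>\<close> that nothing below
    \<open>q\<close> does. Conditions with one or the other are dense, so it is decided densely
    which case of the shift applies.\<close>
  define M where "M q \<alpha> \<longleftrightarrow> (\<exists>x\<in>?A. V q x \<alpha>)" for q \<alpha>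
  define N where "N q \<alpha> \<longleftrightarrow> (\<forall>r. (r, q) \<in> le \<longrightarrow> \<not> M r \<alpha>)" for q \<alpha>
  define H where "H q u w \<longleftrightarrow>
    (case u of Inl x \<Rightarrow> x \<in> ?A \<and> snd w = 0 \<and> V q x (fst w)
      | Inr (\<alpha>, i) \<Rightarrow> fst w = \<alpha> \<and> (snd w = Suc i \<and> M q \<alpha> \<or> snd w = i \<and> N q \<alpha>))"
    for q :: 'p and u :: "'a + 'b \<times> nat" and w
  have M_mono: "M r \<alpha>" if "M q \<alpha>" "(r, q) \<in> le" for q r \<alpha>
    using that mono unfolding M_def by blast
  have N_mono: "N r \<alpha>" if "N q \<alpha>" "(r, q) \<in> le" for q r \<alpha>
    using that transD[OF trans] by (auto simp: N_def)
  have MN: False if "M q \<alpha>" "N q \<alpha>" "q \<in> Field le" for q \<alpha>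
    using that le_refl by (auto simp: N_def)
  have decide: "\<exists>q. (q, p) \<in> le \<and> (M q \<alpha> \<or> N q \<alpha>)" if "p \<in> Field le" for p \<alpha>
    using that le_refl by (auto simp: N_def)
  have H_Inl: "H q (Inl x) (\<beta>, j) \<longleftrightarrow> x \<in> ?A \<and> j = 0 \<and> V q x \<beta>" for q x \<beta> j
    by (simp add: H_def)
  have H_Inr: "H q (Inr (\<alpha>, i)) (\<beta>, j) \<longleftrightarrow>
      \<beta> = \<alpha> \<and> (j = Suc i \<and> M q \<alpha> \<or> j = i \<and> N q \<alpha>)" for q \<alpha> i \<beta> j
    by (simp add: H_def)
  have H_mono: "H r u w" if "H q u w" "(r, q) \<in> le" for q r u w
  proof (cases w)
    case (Pair \<beta> j)
    show ?thesis
    proof (cases u)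
      case (Inl x)
      then show ?thesis using that mono[of q x \<beta> r] unfolding Pair by (simp add: H_Inl)
    next
      case (Inr z)
      then show ?thesis
        using that M_mono[of q \<beta> r] N_mono[of q \<beta> r] unfolding Pair
        by (cases z) (auto simp: H_Inr)
    qed
  qed
  have H_functional: "w = w'" if q: "q \<in> Field le" and H: "H q u w" "H q u w'" for q u w w'
  proof -
    obtain \<beta> j \<beta>' j' where w: "w = (\<beta>, j)" "w' = (\<beta>', j')" by (metis surj_pair)
    show ?thesis
    proof (cases u)
      case (Inl x)
      then show ?thesis using H functional[OF q, of x \<beta> \<beta>'] by (simp add: w H_Inl)
    next
      case (Inr z)
      then show ?thesis using H MN[OF _ _ q] by (cases z) (auto simp: w H_Inr)
    qed
  qed
  have H_injective: "u = u'" if q: "q \<in> Field le" and H: "H q u w" "H q u' w" for q u u' w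
  proof -
    obtain \<beta> j where w: "w = (\<beta>, j)" by (metis surj_pair)
    have Inl_Inr: False if HH: "H q (Inl x) w" "H q (Inr y) w" for x y
    proof (cases y)
      case (Pair \<alpha> i)
      then have "M q \<alpha>" "N q \<alpha>" using HH by (auto simp: w H_Inl H_Inr M_def)
      then show False using MN q by blast
    qed
    show ?thesis
    proof (cases u; cases u')
      fix x y assume "u = Inl x" "u' = Inl y"
      then show ?thesis using H injective[OF q, of x \<beta> y] by (simp add: w H_Inl)
    next
      fix x y assume "u = Inr x" "u' = Inr y"
      then show ?thesis using H MN[OF _ _ q] by (cases x; cases y) (auto simp: w H_Inr)
    qed (use H Inl_Inr in auto)
  qed
  have H_total: "\<exists>q w. (q, p) \<in> le \<and> w \<in> ?B \<times> UNIV \<and> H q u w"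
    if p: "p \<in> Field le" and u: "u \<in> ?A <+> ?B \<times> UNIV" for p u
  proof (cases u)
    case (Inl x)
    then have "x \<in> ?A" using u by auto
    then obtain q y where "(q, p) \<in> le" "y \<in> ?B" "V q x y" using total[OF p] by blast
    then have "(q, p) \<in> le \<and> (y, 0) \<in> ?B \<times> UNIV \<and> H q u (y, 0)"
      using Inl \<open>x \<in> ?A\<close> by (simp add: H_def)
    then show ?thesis by blast
  next
    case (Inr z)
    obtain \<alpha> i where z: "z = (\<alpha>, i)" by (cases z)
    then have "\<alpha> \<in> ?B" using u Inr by auto
    moreover obtain q where q: "(q, p) \<in> le" "M q \<alpha> \<or> N q \<alpha>" using decide[OF p] by blast
    ultimately have "H q u (\<alpha>, Suc i) \<or> H q u (\<alpha>, i)"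
      using Inr z by (simp add: H_def)
    then show ?thesis using q \<open>\<alpha> \<in> ?B\<close> by blast
  qed
  have H_surjective: "\<exists>q u. (q, p) \<in> le \<and> u \<in> ?A <+> ?B \<times> UNIV \<and> H q u w"
    if p: "p \<in> Field le" and w: "w \<in> ?B \<times> UNIV" for p w
  proof -
    obtain \<alpha> i where \<alpha>: "w = (\<alpha>, i)" "\<alpha> \<in> ?B" using w by auto
    obtain q where q: "(q, p) \<in> le" "M q \<alpha> \<or> N q \<alpha>" using decide[OF p] by blast
    have "\<exists>u. u \<in> ?A <+> ?B \<times> UNIV \<and> H q u w"
    proof (cases "N q \<alpha>")
      case True
      then have "Inr (\<alpha>, i) \<in> ?A <+> ?B \<times> UNIV \<and> H q (Inr (\<alpha>, i)) w"
        using \<alpha> by (auto simp: H_def)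
      then show ?thesis by (rule exI)
    next
      case False
      then have M: "M q \<alpha>" using q by blast
      then obtain x where x: "x \<in> ?A" "V q x \<alpha>" by (auto simp: M_def)
      show ?thesis
      proof (cases i)
        case 0
        then have "Inl x \<in> ?A <+> ?B \<times> UNIV \<and> H q (Inl x) w"
          using \<alpha> x by (auto simp: H_def)
        then show ?thesis by (rule exI)
      next
        case (Suc j)
        then have "Inr (\<alpha>, j) \<in> ?A <+> ?B \<times> UNIV \<and> H q (Inr (\<alpha>, j)) w"
          using \<alpha> M by (auto simp: H_def)
        then show ?thesis by (rule exI)
      qed
    qed
    then show ?thesis using q by blast
  qed
  \<comment> \<open>Conjugation by \<open>f\<close> and \<open>g\<close> moves the bijection between
    the enlarged sets back to the fields.\<close>
  let ?H = "\<lambda>q x y. x \<in> ?A \<and> y \<in> ?B \<and> H q (f x) (g y)"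
  show ?thesis
  proof (rule f_same_cardI[OF refl trans, where H = ?H])
    show "?H r x y" if "?H q x y" "(r, q) \<in> le" for q r x y
      using that H_mono by blast
    show "y = z" if "q \<in> Field le" "?H q x y" "?H q x z" for q x y z
      using that H_functional[of q "f x" "g y" "g z"] inj_onD[OF bij_betw_imp_inj_on[OF g]] by simp
    show "x = y" if "q \<in> Field le" "?H q x z" "?H q y z" for q x y z
      using that H_injective[of q "f x" "g z" "f y"] inj_onD[OF bij_betw_imp_inj_on[OF f]] by simp
    show "\<exists>q y. (q, p) \<in> le \<and> y \<in> ?B \<and> ?H q x y" if p: "p \<in> Field le" and x: "x \<in> ?A" for p x
    proof -
      have "f x \<in> ?A <+> ?B \<times> UNIV" using f x bij_betwE by blast
      from H_total[OF p this] obtain q w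
        where "(q, p) \<in> le" "w \<in> ?B \<times> UNIV" "H q (f x) w" by (elim exE conjE)
      moreover from this obtain y where "y \<in> ?B" "g y = w"
        using bij_betw_imp_surj_on[OF g] by (metis imageE)
      ultimately have "(q, p) \<in> le \<and> y \<in> ?B \<and> ?H q x y" using x by simp
      then show ?thesis by (intro exI)
    qed
    show "\<exists>q x. (q, p) \<in> le \<and> x \<in> ?A \<and> ?H q x y" if p: "p \<in> Field le" and y: "y \<in> ?B" for p y
    proof -
      have "g y \<in> ?B \<times> UNIV" using g y bij_betwE by blast
      from H_surjective[OF p this] obtain q u
        where "(q, p) \<in> le" "u \<in> ?A <+> ?B \<times> UNIV" "H q u (g y)" by (elim exE conjE)
      moreover from this obtain x where "x \<in> ?A" "f x = u"
        using bij_betw_imp_surj_on[OF f] by (metis imageE)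
      ultimately have "(q, p) \<in> le \<and> x \<in> ?A \<and> ?H q x y" using y by simp
      then show ?thesis by (intro exI)
    qed
  qed
qed

text \<open>Each \<open>x\<close> is sent to its least preimage: \<open>V q x \<alpha>\<close> says
  that \<open>q\<close> sends \<open>\<alpha>\<close> to \<open>x\<close> and that no stronger
  condition does so with a smaller index. Distinct \<open>x\<close> receive distinct
  \<open>\<alpha>\<close> since \<open>Q\<close> is functional, so \<open>V\<close> is an injection
  as in \<open>f_same_card_if_injection\<close>.\<close>

lemma f_same_card_if_partial_surjection:
  fixes \<kappa> :: "'a rel" and \<mu> :: "'b rel" and Q :: "'p \<Rightarrow> 'b \<Rightarrow> 'a \<Rightarrow> bool"
  assumes refl: "refl_on (Field le) le" and trans: "trans le"
    and wo: "Well_order \<mu>"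
    and inf: "infinite (Field \<mu>)" and small: "|Field \<mu>| \<le>o |Field \<kappa>|"
    and mono: "\<And>q r \<alpha> x. Q q \<alpha> x \<Longrightarrow> (r, q) \<in> le \<Longrightarrow> Q r \<alpha> x"
    and functional: "\<And>q \<alpha> x y. q \<in> Field le \<Longrightarrow> Q q \<alpha> x \<Longrightarrow> Q q \<alpha> y \<Longrightarrow> x = y"
    and surjective: "\<And>p x. p \<in> Field le \<Longrightarrow> x \<in> Field \<kappa> \<Longrightarrow> \<exists>q \<alpha>. (q, p) \<in> le \<and> \<alpha> \<in> Field \<mu> \<and> Q q \<alpha> x"
  shows "holds_in_generic_extensions le (f_same_card le \<kappa> \<mu>)"
proof -
  have le_refl: "(p, p) \<in> le" if "p \<in> Field le" for p
    using refl that by (auto dest: refl_onD)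
  define V where "V q x \<alpha> \<longleftrightarrow> \<alpha> \<in> Field \<mu> \<and> Q q \<alpha> x \<and>
    (\<forall>\<beta>\<in>underS \<mu> \<alpha>. \<forall>r. (r, q) \<in> le \<longrightarrow> \<not> Q r \<beta> x)" for q x \<alpha>
  have wf: "wf (\<mu> - Id)" using wo by (simp add: well_order_on_def)
  have total: "total_on (Field \<mu>) \<mu>"
    using wo by (simp add: well_order_on_def linear_order_on_def)
  show ?thesis
  proof (rule f_same_card_if_injection[OF refl trans inf small, where V = V])
    show "V r x y" if "V q x y" "(r, q) \<in> le" for q r x y
      using that(1) mono[OF _ that(2)] transD[OF trans _ that(2)] unfolding V_def by meson
    show "y = z" if "q \<in> Field le" "V q x y" "V q x z" for q x y z
    proof (rule ccontr)
      assume "y \<noteq> z"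
      moreover have "y \<in> Field \<mu>" "z \<in> Field \<mu>" using that by (simp_all add: V_def)
      ultimately have "y \<in> underS \<mu> z \<or> z \<in> underS \<mu> y"
        using total by (auto simp: total_on_def underS_def)
      moreover have "Q q y x" "Q q z x" using that by (simp_all add: V_def)
      ultimately show False
        using that le_refl[OF that(1)] unfolding V_def by meson
    qed
    show "x = y" if "q \<in> Field le" "V q x z" "V q y z" for q x y z
      using that functional[of q z x y] by (simp add: V_def)
    show "\<exists>q y. (q, p) \<in> le \<and> y \<in> Field \<mu> \<and> V q x y" if p: "p \<in> Field le" "x \<in> Field \<kappa>" for p x
    proof -
      \<comment> \<open>Indices that some extension of \<open>p\<close> sends to \<open>x\<close>.
        Below a witness for the least of them no smaller index can occur, since extensions of the
        witness also extend \<open>p\<close>.\<close>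
      let ?S = "{\<alpha> \<in> Field \<mu>. \<exists>q. (q, p) \<in> le \<and> Q q \<alpha> x}"
      obtain \<alpha>0 where "\<alpha>0 \<in> ?S" using surjective[OF p] by blast
      then obtain \<alpha> where \<alpha>: "\<alpha> \<in> ?S" "\<And>\<beta>. (\<beta>, \<alpha>) \<in> \<mu> - Id \<Longrightarrow> \<beta> \<notin> ?S"
        by (rule wfE_min[OF wf]) blast
      then obtain q where q: "(q, p) \<in> le" "Q q \<alpha> x" by blast
      have "\<not> Q r \<beta> x" if "\<beta> \<in> underS \<mu> \<alpha>" "(r, q) \<in> le" for \<beta> r
      proof -
        have "\<beta> \<notin> ?S" "\<beta> \<in> Field \<mu>"
          using \<alpha>(2) that(1) by (auto simp: underS_def Field_def)
        then show ?thesis using transD[OF trans that(2) q(1)] by blast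
      qed
      then have "V q x \<alpha>" using \<alpha>(1) q unfolding V_def by blast
      then show ?thesis using q \<alpha>(1) by blast
    qed
  qed
qed

section \<open>Families of infinite sets of natural numbers\<close>

definition inf_sets :: "('e \<Rightarrow> nat set) \<Rightarrow> bool" where
  "inf_sets X \<longleftrightarrow> (\<forall>e. infinite (X e))"

definition almost_subsets :: "('e \<Rightarrow> nat set) \<Rightarrow> ('e \<Rightarrow> nat set) \<Rightarrow> bool" where
  "almost_subsets Y X \<longleftrightarrow> (\<forall>e. finite (Y e - X e))"

lemma finite_Diff_trans: "finite (A - B) \<Longrightarrow> finite (B - C) \<Longrightarrow> finite (A - C)"
  by (rule finite_subset[of _ "(A - B) \<union> (B - C)"]) auto

text \<open>A diagonal choice of \<open>y m \<in> X m\<close> with \<open>y m \<ge> m\<close> has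
  infinite range, and all terms from the m-th on lie in \<open>X m\<close>. This is the
  \<sigma>-closure of P(\<omega>)/fin.\<close>

lemma decseq_pseudointersection:
  fixes X :: "nat \<Rightarrow> nat set"
  assumes inf: "\<And>m. infinite (X m)" and dec: "decseq X"
  shows "\<exists>Y. infinite Y \<and> Y \<subseteq> X 0 \<and> (\<forall>m. finite (Y - X m))"
proof -
  have "\<exists>y\<ge>m. y \<in> X m" for m
    using inf[of m] by (meson infinite_nat_iff_unbounded_le)
  then obtain y where y: "\<And>m. y m \<ge> m" "\<And>m. y m \<in> X m" by metis
  have "infinite (range y)"
    unfolding infinite_nat_iff_unbounded_le using y(1) by blast
  moreover have "finite (range y - X m)" for m
  proof (rule finite_subset)
    show "range y - X m \<subseteq> y ` {..<m}"
      using y(2) decseqD[OF dec, of m] by (force simp: not_le[symmetric])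
  qed simp
  moreover have "range y \<subseteq> X 0" using y(2) decseqD[OF dec, of 0] by blast
  ultimately show ?thesis by blast
qed

lemma decreasing_families_pseudointersection:
  fixes X :: "nat \<Rightarrow> 'e \<Rightarrow> nat set"
  assumes inf: "\<And>m. inf_sets (X m)" and dec: "\<And>m. X (Suc m) \<le> X m"
  shows "\<exists>Y. inf_sets Y \<and> Y \<le> X 0 \<and> (\<forall>m. almost_subsets Y (X m))"
proof -
  have "\<exists>Y. infinite Y \<and> Y \<subseteq> X 0 e \<and> (\<forall>m. finite (Y - X m e))" for e
  proof (rule decseq_pseudointersection)
    show "infinite (X m e)" for m using inf by (simp add: inf_sets_def)
    show "decseq (\<lambda>m. X m e)" using dec by (intro decseq_SucI) (simp add: le_fun_def)
  qed
  then obtain Y where "\<And>e. infinite (Y e) \<and> Y e \<subseteq> X 0 e \<and> (\<forall>m. finite (Y e - X m e))" by metis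
  then show ?thesis
    unfolding inf_sets_def almost_subsets_def le_fun_def by blast
qed

text \<open>A decreasing sequence meets the countably many dense requirements in turn, and a
  pseudointersection inherits them all because they persist under almost inclusion. The outcome is a
  true pointwise subfamily of \<open>X\<close>, as the pruning of trees requires.\<close>

lemma countable_shrinking:
  fixes P :: "'t::countable \<Rightarrow> ('e \<Rightarrow> nat set) \<Rightarrow> bool"
  assumes hereditary: "\<And>t X Y. P t X \<Longrightarrow> almost_subsets Y X \<Longrightarrow> P t Y"
    and dense: "\<And>t X. inf_sets X \<Longrightarrow> \<exists>Y. inf_sets Y \<and> Y \<le> X \<and> P t Y"
    and X: "inf_sets X"
  shows "\<exists>Y. inf_sets Y \<and> Y \<le> X \<and> (\<forall>t. P t Y)"
proof -
  have "\<exists>Z. Z 0 = X \<and> (\<forall>m. inf_sets (Z m)) \<and>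
      (\<forall>m. Z (Suc m) \<le> Z m \<and> P (from_nat m) (Z (Suc m)))"
  proof -
    define Z where "Z = rec_nat X (\<lambda>m W. SOME Y. inf_sets Y \<and> Y \<le> W \<and> P (from_nat m) Y)"
    have Z: "Z 0 = X" "Z (Suc m) = (SOME Y. inf_sets Y \<and> Y \<le> Z m \<and> P (from_nat m) Y)" for m
      by (simp_all add: Z_def)
    have step: "inf_sets (Z (Suc m)) \<and> Z (Suc m) \<le> Z m \<and> P (from_nat m) (Z (Suc m))"
      if "inf_sets (Z m)" for m
      using someI_ex[OF dense[OF that, of "from_nat m"]] unfolding Z(2) .
    have "inf_sets (Z m)" for m
      by (induction m) (use X Z(1) step in auto)
    then show ?thesis using step Z(1) by blast
  qed
  then obtain Z where Z: "Z 0 = X" "\<And>m. inf_sets (Z m)" "\<And>m. Z (Suc m) \<le> Z m"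
    "\<And>m. P (from_nat m) (Z (Suc m))" by blast
  obtain Y where Y: "inf_sets Y" "Y \<le> X" "\<And>m. almost_subsets Y (Z m)"
    using decreasing_families_pseudointersection[of Z, OF Z(2,3)] Z(1) by blast
  have "P t Y" for t
    using hereditary[OF Z(4)[of "to_nat t"] Y(3)] by simp
  then show ?thesis using Y by blast
qed

section \<open>The product order on tuples\<close>

text \<open>Conditions are handled through representatives, total sequences of sets of which the
  first \<open>n\<close> are compared modulo finite.\<close>

definition tuple_le :: "nat \<Rightarrow> (nat \<Rightarrow> nat set) \<Rightarrow> (nat \<Rightarrow> nat set) \<Rightarrow> bool" where
  "tuple_le n x y \<longleftrightarrow> (\<forall>i<n. finite (x i - y i))"

lemma tuple_le_refl: "tuple_le n x x"
  by (simp add: tuple_le_def)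

lemma tuple_le_trans: "tuple_le n x y \<Longrightarrow> tuple_le n y z \<Longrightarrow> tuple_le n x z"
  unfolding tuple_le_def using finite_Diff_trans by blast

lemma tuple_le_if_le: "x \<le> y \<Longrightarrow> tuple_le n x y"
  unfolding tuple_le_def le_fun_def by (metis Diff_eq_empty_iff finite.emptyI)

lemma tuple_le_if_almost_subsets: "almost_subsets x y \<Longrightarrow> tuple_le n x y"
  unfolding tuple_le_def almost_subsets_def by blast

text \<open>Choose a coordinate where \<open>x i - y i\<close> is infinite and shrink
  \<open>x i\<close> to that difference; whatever lies below the result is almost disjoint from
  \<open>y i\<close> there.\<close>

lemma tuple_separative:
  assumes "inf_sets x" "\<not> tuple_le n x y"
  shows "\<exists>z. inf_sets z \<and> z \<le> x \<and> (\<forall>w. inf_sets w \<longrightarrow> tuple_le n w z \<longrightarrow> \<not> tuple_le n w y)"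
proof -
  obtain i where i: "i < n" "infinite (x i - y i)"
    using assms(2) by (auto simp: tuple_le_def)
  let ?z = "x(i := x i - y i)"
  have "\<not> tuple_le n w y" if "inf_sets w" "tuple_le n w ?z" for w
  proof
    assume "tuple_le n w y"
    then have "finite ((w i - (x i - y i)) \<union> (w i - y i))"
      using that i by (auto simp: tuple_le_def dest!: spec[of _ i])
    then have "finite (w i)" by (rule rev_finite_subset) blast
    then show False using that by (simp add: inf_sets_def)
  qed
  moreover have "inf_sets ?z" "?z \<le> x" using assms i by (auto simp: inf_sets_def le_fun_def)
  ultimately show ?thesis by blast
qed

text \<open>Reads a condition off a family at the nodes listed in \<open>t\<close>. Past the end of
  \<open>t\<close> the node \<open>t ! i\<close> is unspecified, but under \<open>inf_sets X\<close>
  the set there is infinite all the same.\<close>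

definition tuple_of :: "('e \<Rightarrow> nat set) \<Rightarrow> 'e list \<Rightarrow> nat \<Rightarrow> nat set" where
  "tuple_of X t i = X (t ! i)"

lemma inf_sets_tuple_of: "inf_sets X \<Longrightarrow> inf_sets (tuple_of X t)"
  by (simp add: inf_sets_def tuple_of_def)

lemma tuple_of_almost_subsets: "almost_subsets Y X \<Longrightarrow> tuple_le n (tuple_of Y t) (tuple_of X t)"
  by (simp add: tuple_of_def tuple_le_def almost_subsets_def)

text \<open>As the nodes in \<open>t\<close> are distinct, each can be shrunk independently:
  intersect \<open>X (t ! i)\<close> with \<open>u i\<close> and leave all other nodes
  alone.\<close>

lemma shrink_tuple_of:
  assumes X: "inf_sets X" and t: "distinct t" "length t = n"
    and u: "inf_sets u" "tuple_le n u (tuple_of X t)"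
  shows "\<exists>Y. inf_sets Y \<and> Y \<le> X \<and> tuple_le n (tuple_of Y t) u"
proof -
  define Y where "Y e = (if e \<in> set t then X e \<inter> u (THE i. i < n \<and> t ! i = e) else X e)" for e
  have the: "(THE j. j < n \<and> t ! j = t ! i) = i" if "i < n" for i
    using that t by (auto simp: nth_eq_iff_index_eq)
  then have Yt: "Y (t ! i) = X (t ! i) \<inter> u i" if "i < n" for i
    using that t by (simp add: Y_def)
  have "infinite (Y (t ! i))" if "i < n" for i
  proof
    assume "finite (Y (t ! i))"
    moreover have "finite (u i - X (t ! i))" using u that by (simp add: tuple_le_def tuple_of_def)
    ultimately have "finite (Y (t ! i) \<union> (u i - X (t ! i)))" by simp
    then have "finite (u i)" by (rule rev_finite_subset) (auto simp: Yt[OF that])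
    then show False using u by (simp add: inf_sets_def)
  qed
  moreover have "infinite (Y e)" if "e \<notin> set t" for e
    using that X by (simp add: inf_sets_def Y_def)
  ultimately have "infinite (Y e)" for e
    using t(2) by (metis in_set_conv_nth)
  moreover have "Y \<le> X" by (auto simp: Y_def le_fun_def)
  moreover have "tuple_le n (tuple_of Y t) u"
    using Yt by (simp add: tuple_le_def tuple_of_def Int_commute Diff_eq_empty_iff[THEN iffD2])
  ultimately show ?thesis by (auto simp: inf_sets_def)
qed

section \<open>Distributivity in terms of dense sets of tuples\<close>

text \<open>The cone below \<open>p\<close> is the least open set containing \<open>p\<close>, so
  interiors can be tested on cones.\<close>

lemma in_ro_Inf_poset_topology:
  assumes refl: "refl_on (Field le) le" and trans: "trans le"
  shows "p \<in> ro_Inf (poset_topology le) \<U> \<longleftrightarrow>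
    p \<in> Field le \<and> (\<forall>q. (q, p) \<in> le \<longrightarrow> (\<forall>U\<in>\<U>. q \<in> U))"
proof
  assume "p \<in> ro_Inf (poset_topology le) \<U>"
  then obtain T where "openin (poset_topology le) T" "p \<in> T" "T \<subseteq> Field le \<inter> \<Inter>\<U>"
    unfolding ro_Inf_def interior_of_def topspace_poset_topology by blast
  then show "p \<in> Field le \<and> (\<forall>q. (q, p) \<in> le \<longrightarrow> (\<forall>U\<in>\<U>. q \<in> U))"
    unfolding openin_poset_topology by blast
next
  assume p: "p \<in> Field le \<and> (\<forall>q. (q, p) \<in> le \<longrightarrow> (\<forall>U\<in>\<U>. q \<in> U))"
  have "openin (poset_topology le) {q. (q, p) \<in> le}"
    unfolding openin_poset_topology using trans by (auto simp: Field_def dest: transD)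
  moreover have "{q. (q, p) \<in> le} \<subseteq> Field le \<inter> \<Inter>\<U>" using p by (auto simp: Field_def)
  moreover have "p \<in> {q. (q, p) \<in> le}" using p refl by (auto dest: refl_onD)
  ultimately show "p \<in> ro_Inf (poset_topology le) \<U>"
    unfolding ro_Inf_def interior_of_def topspace_poset_topology by blast
qed

lemma in_ro_Sup_poset_topology:
  assumes "refl_on (Field le) le" "trans le"
  shows "p \<in> ro_Sup (poset_topology le) \<U> \<longleftrightarrow> p \<in> Field le \<and> dense_below le (\<Union>\<U>) p"
  unfolding ro_Sup_def interior_closure_poset_topology[OF assms] by simp

text \<open>One inclusion of the law always holds, so a failure yields a point of the left side
  outside the right side, and below it a \<open>q\<close> whose extensions avoid the union on the
  right. An extension lying in a member of every \<open>A \<alpha>\<close> would determine a choice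
  function and, the members being open, lie in that union.\<close>

lemma not_ro_distributiveE:
  assumes refl: "refl_on (Field le) le" and trans: "trans le"
    and "\<not> ro_distributive \<kappa> le"
  obtains q A where "q \<in> Field le" "\<forall>\<alpha>\<in>Field \<kappa>. A \<alpha> \<subseteq> regular_opens (poset_topology le)"
    "\<forall>\<alpha>\<in>Field \<kappa>. dense_below le (\<Union>(A \<alpha>)) q"
    "\<And>r. (r, q) \<in> le \<Longrightarrow> \<exists>\<alpha>\<in>Field \<kappa>. r \<notin> \<Union>(A \<alpha>)"
proof -
  let ?X = "poset_topology le" and ?K = "Field \<kappa>"
  obtain A where A: "\<forall>\<alpha>\<in>?K. A \<alpha> \<subseteq> regular_opens ?X"
    and neq: "ro_Inf ?X {ro_Sup ?X (A \<alpha>) | \<alpha>. \<alpha> \<in> ?K} \<noteq>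
      ro_Sup ?X {ro_Inf ?X (f ` ?K) | f. \<forall>\<alpha>\<in>?K. f \<alpha> \<in> A \<alpha>}" (is "?L \<noteq> ?R")
    using assms(3) unfolding ro_distributive_def Let_def by blast
  note inI = in_ro_Inf_poset_topology[OF refl trans]
  note inS = in_ro_Sup_poset_topology[OF refl trans]
  have le_refl: "(p, p) \<in> le" if "p \<in> Field le" for p
    using refl that by (auto dest: refl_onD)
  have inF: "q \<in> Field le" "p \<in> Field le" if "(q, p) \<in> le" for p q
    using that by (auto simp: Field_def)
  have "?R \<subseteq> ?L"
  proof
    fix p assume "p \<in> ?R"
    then have p: "p \<in> Field le"
      "dense_below le (\<Union>{ro_Inf ?X (f ` ?K) | f. \<forall>\<alpha>\<in>?K. f \<alpha> \<in> A \<alpha>}) p"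
      unfolding inS by blast+
    have "q \<in> ro_Sup ?X (A \<alpha>)" if q: "(q, p) \<in> le" and \<alpha>: "\<alpha> \<in> ?K" for q \<alpha>
      unfolding inS dense_below_def
    proof (intro conjI allI impI)
      show "q \<in> Field le" using inF q by blast
      fix q' assume "(q', q) \<in> le"
      then have "(q', p) \<in> le" using q transD[OF trans] by blast
      then obtain r f where r: "(r, q') \<in> le" "r \<in> ro_Inf ?X (f ` ?K)" "\<forall>\<alpha>\<in>?K. f \<alpha> \<in> A \<alpha>"
        using p(2) unfolding dense_below_def by blast
      then have "r \<in> f \<alpha>" using \<alpha> le_refl unfolding inI by blast
      then show "\<exists>r\<in>\<Union>(A \<alpha>). (r, q') \<in> le" using r \<alpha> by blast
    qed
    then show "p \<in> ?L" using p(1) unfolding inI by blast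
  qed
  then obtain p where p: "p \<in> ?L" "p \<notin> ?R" using neq by blast
  have pF: "p \<in> Field le" using p(1) unfolding inI by blast
  then have sup: "p \<in> ro_Sup ?X (A \<alpha>)" if "\<alpha> \<in> ?K" for \<alpha>
    using p(1) le_refl that unfolding inI by blast
  obtain q where q: "(q, p) \<in> le"
    and no: "\<And>r. (r, q) \<in> le \<Longrightarrow> r \<notin> \<Union>{ro_Inf ?X (f ` ?K) | f. \<forall>\<alpha>\<in>?K. f \<alpha> \<in> A \<alpha>}"
    using p(2) pF unfolding inS dense_below_def by blast
  show thesis
  proof (rule that)
    show "q \<in> Field le" using inF q by blast
    show "\<forall>\<alpha>\<in>?K. A \<alpha> \<subseteq> regular_opens ?X" by (rule A)
    show "\<forall>\<alpha>\<in>?K. dense_below le (\<Union>(A \<alpha>)) q"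
      using sup transD[OF trans _ q] unfolding inS dense_below_def by blast
    fix r assume r: "(r, q) \<in> le"
    show "\<exists>\<alpha>\<in>?K. r \<notin> \<Union>(A \<alpha>)"
    proof (rule ccontr)
      assume "\<not> ?thesis"
      then have "\<forall>\<alpha>\<in>?K. \<exists>U. U \<in> A \<alpha> \<and> r \<in> U" by blast
      then obtain f where f: "\<forall>\<alpha>\<in>?K. f \<alpha> \<in> A \<alpha> \<and> r \<in> f \<alpha>" by metis
      have "s \<in> f \<alpha>" if "(s, r) \<in> le" "\<alpha> \<in> ?K" for s \<alpha>
      proof -
        have "openin ?X (f \<alpha>)" using A f that(2) by (auto simp: regular_opens_def)
        then show ?thesis using that f unfolding openin_poset_topology by blast
      qed
      then have "r \<in> ro_Inf ?X (f ` ?K)" using inF(1)[OF r] unfolding inI by blast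
      then show False using no[OF r] f by blast
    qed
  qed
qed

section \<open>Representatives of conditions, and antichains of tuples\<close>

definition tuple_class :: "nat \<Rightarrow> (nat \<Rightarrow> nat set) \<Rightarrow> nat \<Rightarrow> nat set set" where
  "tuple_class n x = (\<lambda>i\<in>{..<n}. eq_fin `` {x i})"

lemma tuple_class_in_Field: "inf_sets x \<Longrightarrow> tuple_class n x \<in> Field (P_fin_power n)"
  unfolding P_fin_power_Field tuple_class_def inf_sets_def
  using P_fin_nonzero by (intro restrict_PiE_iff[THEN iffD2]) blast

lemma tuple_class_le_iff:
  assumes "inf_sets x" "inf_sets y"
  shows "(tuple_class n x, tuple_class n y) \<in> P_fin_power n \<longleftrightarrow> tuple_le n x y"
  using tuple_class_in_Field[OF assms(1), of n] tuple_class_in_Field[OF assms(2), of n]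
  unfolding P_fin_power_Field
  by (auto simp: P_fin_power_def tuple_le_def tuple_class_def P_fin_le_class)

lemma Field_P_fin_powerE:
  assumes "a \<in> Field (P_fin_power n)"
  obtains x where "inf_sets x" "a = tuple_class n x"
proof -
  have a: "a \<in> {..<n} \<rightarrow>\<^sub>E P_fin - {P_fin_zero}" using assms by (simp only: P_fin_power_Field)
  have "\<exists>X. infinite X \<and> (i < n \<longrightarrow> a i = eq_fin `` {X})" for i
    using PiE_mem[OF a, of i] unfolding P_fin_nonzero
    by (cases "i < n") (use infinite_UNIV_nat in auto)
  then obtain x where x: "\<And>i. infinite (x i) \<and> (i < n \<longrightarrow> a i = eq_fin `` {x i})" by metis
  then have "a i = tuple_class n x i" for i
    using PiE_arb[OF a, of i] by (auto simp: tuple_class_def)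
  then show thesis using that[of x] x by (auto simp: inf_sets_def)
qed

definition tuple_antichain :: "nat \<Rightarrow> (nat \<Rightarrow> nat set) set \<Rightarrow> bool" where
  "tuple_antichain n B \<longleftrightarrow> (\<forall>b\<in>B. inf_sets b) \<and>
     (\<forall>b\<in>B. \<forall>b'\<in>B. \<forall>z. inf_sets z \<and> tuple_le n z b \<and> tuple_le n z b' \<longrightarrow> b = b')"

definition tuple_below :: "nat \<Rightarrow> (nat \<Rightarrow> nat set) set \<Rightarrow> (nat \<Rightarrow> nat set) \<Rightarrow> bool" where
  "tuple_below n B x \<longleftrightarrow> (\<exists>b\<in>B. tuple_le n x b)"

lemma tuple_below_mono: "tuple_below n B y \<Longrightarrow> tuple_le n x y \<Longrightarrow> tuple_below n B x"
  unfolding tuple_below_def using tuple_le_trans by blast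

text \<open>Zorn's lemma with \<open>C\<close> as compatibility: an element of \<open>D\<close>
  compatible with no member of a maximal \<open>B\<close> could be added to it.\<close>

lemma maximal_pairwise_incompatible:
  fixes D :: "'a set"
  assumes refl: "\<And>x. C x x" and sym: "\<And>x y. C x y \<Longrightarrow> C y x"
  shows "\<exists>B\<subseteq>D. (\<forall>b\<in>B. \<forall>b'\<in>B. C b b' \<longrightarrow> b = b') \<and> (\<forall>x\<in>D. \<exists>b\<in>B. C x b)"
proof -
  let ?S = "{B. B \<subseteq> D \<and> (\<forall>b\<in>B. \<forall>b'\<in>B. C b b' \<longrightarrow> b = b')}"
  have "\<exists>M\<in>?S. \<forall>X\<in>?S. M \<subseteq> X \<longrightarrow> X = M"
  proof (rule subset_Zorn')
    fix c assume c: "subset.chain ?S c"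
    have chain: "c \<subseteq> ?S" "\<And>X Y. X \<in> c \<Longrightarrow> Y \<in> c \<Longrightarrow> X \<subseteq> Y \<or> Y \<subseteq> X"
      using c by (auto simp: subset_chain_def)
    have "b = b'" if b: "b \<in> \<Union>c" "b' \<in> \<Union>c" and Cbb: "C b b'" for b b'
    proof -
      obtain X Y where XY: "X \<in> c" "b \<in> X" "Y \<in> c" "b' \<in> Y" using b by blast
      then obtain Z where "Z \<in> c" "b \<in> Z" "b' \<in> Z" using chain(2)[of X Y] by blast
      then show ?thesis using chain(1) Cbb by blast
    qed
    moreover have "\<Union>c \<subseteq> D" using chain(1) by blast
    ultimately show "\<Union>c \<in> ?S" by blast
  qed
  then obtain B where B: "B \<in> ?S" "\<forall>X\<in>?S. B \<subseteq> X \<longrightarrow> X = B" by (elim bexE)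
  have "\<exists>b\<in>B. C x b" if x: "x \<in> D" for x
  proof (rule ccontr)
    assume no: "\<not> ?thesis"
    then have "insert x B \<in> ?S" using x B(1) sym by blast
    from bspec[OF B(2) this] have "x \<in> B" by auto
    then show False using no refl by blast
  qed
  then show ?thesis using B(1) by (intro exI[of _ B]) simp
qed

text \<open>Take a maximal antichain inside \<open>D\<close>. Given \<open>x\<close>, first pass
  below it into \<open>D\<close>; the element found there is compatible with some member.\<close>

lemma dense_open_tuple_antichain:
  assumes D: "\<And>x. x \<in> D \<Longrightarrow> inf_sets x"
    and dense: "\<And>x. inf_sets x \<Longrightarrow> \<exists>y\<in>D. tuple_le n y x"
  shows "\<exists>B\<subseteq>D. tuple_antichain n B \<and> (\<forall>x. inf_sets x \<longrightarrow>
    (\<exists>y. inf_sets y \<and> tuple_le n y x \<and> tuple_below n B y))"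
proof -
  \<comment> \<open>The disjunct \<open>x = y\<close> makes the relation reflexive on all functions,
    including those with finite coordinates.\<close>
  let ?C = "\<lambda>x y. x = y \<or> (\<exists>z. inf_sets z \<and> tuple_le n z x \<and> tuple_le n z y)"
  have "\<exists>B\<subseteq>D. (\<forall>b\<in>B. \<forall>b'\<in>B. ?C b b' \<longrightarrow> b = b') \<and> (\<forall>x\<in>D. \<exists>b\<in>B. ?C x b)"
    by (rule maximal_pairwise_incompatible) auto
  then obtain B
    where B: "B \<subseteq> D" "\<forall>b\<in>B. \<forall>b'\<in>B. ?C b b' \<longrightarrow> b = b'" "\<forall>x\<in>D. \<exists>b\<in>B. ?C x b"
    by (elim exE conjE)
  have "tuple_antichain n B" using B(1,2) D unfolding tuple_antichain_def by blast
  moreover have "\<exists>y. inf_sets y \<and> tuple_le n y x \<and> tuple_below n B y" if x: "inf_sets x" for x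
  proof -
    obtain d where d: "d \<in> D" "tuple_le n d x" using dense[OF x] by blast
    then obtain b where b: "b \<in> B" "?C d b" using B(3) by blast
    then have "\<exists>z. inf_sets z \<and> tuple_le n z d \<and> tuple_le n z b"
      using D[OF d(1)] tuple_le_refl by blast
    then show ?thesis using b d tuple_le_trans unfolding tuple_below_def by blast
  qed
  ultimately show ?thesis using B(1) by (intro exI[of _ B]) simp
qed

text \<open>
  Non-distributivity is witnessed below some condition \<open>q\<close> only; the enumerations of the
  coordinates of \<open>q\<close> transport the witness to all conditions.
\<close>

lemma not_ro_distributive_antichains:
  assumes nd: "\<not> ro_distributive \<kappa> (P_fin_power n)"
  shows "\<exists>B. (\<forall>\<alpha>\<in>Field \<kappa>. tuple_antichain n (B \<alpha>)) \<and>
    (\<forall>\<alpha>\<in>Field \<kappa>. \<forall>x. inf_sets x \<longrightarrow> (\<exists>y. inf_sets y \<and> tuple_le n y x \<and> tuple_below n (B \<alpha>) y)) \<and>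
    (\<forall>x. inf_sets x \<longrightarrow> (\<exists>\<alpha>\<in>Field \<kappa>. \<not> tuple_below n (B \<alpha>) x))"
proof -
  let ?le = "P_fin_power n" and ?K = "Field \<kappa>"
  obtain q A where q: "q \<in> Field ?le"
    and A: "\<forall>\<alpha>\<in>?K. A \<alpha> \<subseteq> regular_opens (poset_topology ?le)"
    and dense: "\<forall>\<alpha>\<in>?K. dense_below ?le (\<Union>(A \<alpha>)) q"
    and no: "\<And>r. (r, q) \<in> ?le \<Longrightarrow> \<exists>\<alpha>\<in>?K. r \<notin> \<Union>(A \<alpha>)"
    using not_ro_distributiveE[OF P_fin_power_refl P_fin_power_trans nd] by blast
  obtain w where w: "inf_sets w" "q = tuple_class n w" using q by (rule Field_P_fin_powerE)
  define E where "E x i = enumerate (w i) ` x i" for x i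
  have inj: "inj (enumerate (w i))" and ran: "range (enumerate (w i)) = w i" for i
    using w(1) by (simp_all add: inf_sets_def inj_enumerate range_enumerate)
  have E_inf: "inf_sets (E x)" if "inf_sets x" for x
    using that inj unfolding inf_sets_def E_def by (meson finite_imageD inj_on_subset subset_UNIV)
  have E_le: "tuple_le n (E x) (E y)" if "tuple_le n x y" for x y
    unfolding tuple_le_def
  proof (intro allI impI)
    fix i assume "i < n"
    then have "finite (enumerate (w i) ` (x i - y i))" using that by (simp add: tuple_le_def)
    then show "finite (E x i - E y i)" by (rule rev_finite_subset) (auto simp: E_def)
  qed
  have E_w: "E x \<le> w" for x using ran by (force simp: E_def le_fun_def)
  have up: "\<exists>\<alpha>\<in>?K. tuple_class n (E x) \<notin> \<Union>(A \<alpha>)" if "inf_sets x" for x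
    using no[of "tuple_class n (E x)"] tuple_class_le_iff[OF E_inf[OF that] w(1), of n]
      tuple_le_if_le[OF E_w] w(2) by blast
  have A_open: "r \<in> \<Union>(A \<alpha>)" if \<alpha>: "\<alpha> \<in> ?K" and s: "s \<in> \<Union>(A \<alpha>)" and rs: "(r, s) \<in> ?le" for \<alpha> r s
  proof -
    obtain U where U: "U \<in> A \<alpha>" "s \<in> U" using s by blast
    then have "openin (poset_topology ?le) U" using A \<alpha> by (auto simp: regular_opens_def)
    then show ?thesis using U rs unfolding openin_poset_topology by blast
  qed
  define D where "D \<alpha> = {x. inf_sets x \<and> tuple_class n (E x) \<in> \<Union>(A \<alpha>)}" for \<alpha>
  have D_open: "x \<in> D \<alpha>" if "\<alpha> \<in> ?K" "inf_sets x" "y \<in> D \<alpha>" "tuple_le n x y" for x y \<alpha>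
    using that A_open[OF that(1)] tuple_class_le_iff[OF E_inf E_inf] E_le
    unfolding D_def by blast
  have D_dense: "\<exists>x\<in>D \<alpha>. tuple_le n x y" if \<alpha>: "\<alpha> \<in> ?K" and y: "inf_sets y" for \<alpha> y
  proof -
    have "(tuple_class n (E y), q) \<in> ?le"
      using tuple_class_le_iff[OF E_inf[OF y] w(1)] tuple_le_if_le[OF E_w] w(2) by blast
    then obtain r where r: "r \<in> \<Union>(A \<alpha>)" "(r, tuple_class n (E y)) \<in> ?le"
      using bspec[OF dense \<alpha>] unfolding dense_below_def by (elim allE impE bexE)
    then have "r \<in> Field ?le" by (auto simp: Field_def)
    then obtain z where z: "inf_sets z" "r = tuple_class n z" by (rule Field_P_fin_powerE)
    have zy: "tuple_le n z (E y)" using r(2) z tuple_class_le_iff[OF z(1) E_inf[OF y]] by blast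
    \<comment> \<open>Pull \<open>z\<close> back along the enumerations inside \<open>y\<close>, so
      that \<open>x\<close> lies below \<open>y\<close> and \<open>E x\<close> below
      \<open>z\<close>. Coordinates from \<open>n\<close> on keep the value of \<open>y\<close> and
      thus stay infinite.\<close>
    define x where "x i = (if i < n then {k \<in> y i. enumerate (w i) k \<in> z i} else y i)" for i
    have Ex: "E x i = E y i \<inter> z i" if "i < n" for i
      using that by (auto simp: E_def x_def)
    have "infinite (x i)" for i
    proof (cases "i < n")
      case True
      have "infinite (E y i \<inter> z i)"
      proof
        assume "finite (E y i \<inter> z i)"
        moreover have "finite (z i - E y i)" using zy True by (simp add: tuple_le_def)
        ultimately have "finite ((E y i \<inter> z i) \<union> (z i - E y i))" by simp
        then have "finite (z i)" by (rule rev_finite_subset) blast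
        then show False using z(1) by (simp add: inf_sets_def)
      qed
      then have "infinite (enumerate (w i) ` x i)" using Ex[OF True] by (simp add: E_def)
      then show ?thesis by blast
    next
      case False
      then show ?thesis using y by (simp add: x_def inf_sets_def)
    qed
    then have x: "inf_sets x" by (simp add: inf_sets_def)
    have "tuple_le n (E x) z" using Ex by (simp add: tuple_le_def Diff_eq_empty_iff[THEN iffD2])
    then have "(tuple_class n (E x), r) \<in> ?le"
      using tuple_class_le_iff[OF E_inf[OF x] z(1)] z(2) by blast
    then have "x \<in> D \<alpha>" using A_open[OF \<alpha> r(1)] x by (simp add: D_def)
    moreover have "x \<le> y" by (auto simp: x_def le_fun_def)
    ultimately show ?thesis using tuple_le_if_le by blast
  qed
  have "\<forall>\<alpha>\<in>?K. \<exists>B\<subseteq>D \<alpha>. tuple_antichain n B \<and> (\<forall>x. inf_sets x \<longrightarrow>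
      (\<exists>y. inf_sets y \<and> tuple_le n y x \<and> tuple_below n B y))"
    by (intro ballI dense_open_tuple_antichain D_dense) (simp add: D_def)
  then obtain B where B: "\<forall>\<alpha>\<in>?K. B \<alpha> \<subseteq> D \<alpha> \<and> tuple_antichain n (B \<alpha>) \<and> (\<forall>x. inf_sets x \<longrightarrow>
      (\<exists>y. inf_sets y \<and> tuple_le n y x \<and> tuple_below n (B \<alpha>) y))"
    by metis
  moreover have "\<exists>\<alpha>\<in>?K. \<not> tuple_below n (B \<alpha>) x" if x: "inf_sets x" for x
  proof -
    obtain \<alpha> where \<alpha>: "\<alpha> \<in> ?K" "tuple_class n (E x) \<notin> \<Union>(A \<alpha>)" using up[OF x] by blast
    then have "x \<notin> D \<alpha>" by (simp add: D_def)
    then have "\<not> tuple_below n (B \<alpha>) x"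
      using D_open[OF \<alpha>(1) x] B \<alpha>(1) unfolding tuple_below_def by blast
    then show ?thesis using \<alpha>(1) by blast
  qed
  ultimately show ?thesis by (intro exI[of _ B]) simp
qed

text \<open>Apply the law to the cones \<open>U b\<close> for \<open>b \<in> B \<beta>\<close>,
  which are regular open by separativity. Density makes every supremum on the left the whole space;
  the right side then gives a condition below \<open>x\<close> that lies in one cone from each
  level.\<close>

lemma ro_distributive_common_refinement:
  assumes distr: "ro_distributive \<mu> (P_fin_power n)"
    and B: "\<And>\<beta> b. \<beta> \<in> Field \<mu> \<Longrightarrow> b \<in> B \<beta> \<Longrightarrow> inf_sets b"
    and dense: "\<And>\<beta> x. \<beta> \<in> Field \<mu> \<Longrightarrow> inf_sets x \<Longrightarrow>
      \<exists>y. inf_sets y \<and> tuple_le n y x \<and> tuple_below n (B \<beta>) y"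
    and x: "inf_sets x"
  shows "\<exists>y. inf_sets y \<and> tuple_le n y x \<and> (\<forall>\<beta>\<in>Field \<mu>. tuple_below n (B \<beta>) y)"
proof -
  let ?le = "P_fin_power n" and ?K = "Field \<mu>"
  let ?X = "poset_topology ?le"
  note inI = in_ro_Inf_poset_topology[OF P_fin_power_refl P_fin_power_trans]
  note inS = in_ro_Sup_poset_topology[OF P_fin_power_refl P_fin_power_trans]
  define U where "U b = {r. (r, tuple_class n b) \<in> ?le}" for b
  have in_U: "tuple_class n z \<in> U b \<longleftrightarrow> tuple_le n z b" if "inf_sets z" "inf_sets b" for z b
    using tuple_class_le_iff[OF that] by (simp add: U_def)
  have U: "U b \<in> regular_opens ?X" if b: "inf_sets b" for b
  proof -
    have op: "openin ?X (U b)"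
      unfolding openin_poset_topology U_def using P_fin_power_trans
      by (auto simp: Field_def dest: transD)
    have "p \<in> U b \<longleftrightarrow> p \<in> Field ?le \<and> dense_below ?le (U b) p" for p
    proof
      assume "p \<in> U b"
      then show "p \<in> Field ?le \<and> dense_below ?le (U b) p"
        using op P_fin_power_refl[of n] unfolding openin_poset_topology dense_below_def
        by (meson refl_onD subsetD)
    next
      assume p: "p \<in> Field ?le \<and> dense_below ?le (U b) p"
      then obtain z where z: "inf_sets z" "p = tuple_class n z" by (meson Field_P_fin_powerE)
      show "p \<in> U b"
      proof (rule ccontr)
        assume "p \<notin> U b"
        then have "\<not> tuple_le n z b" using in_U z b by blast
        then obtain v where v: "inf_sets v" "v \<le> z"
          "\<And>w. inf_sets w \<Longrightarrow> tuple_le n w v \<Longrightarrow> \<not> tuple_le n w b"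
          using tuple_separative[OF z(1)] by blast
        have "(tuple_class n v, p) \<in> ?le"
          using v z tuple_class_le_iff[OF v(1) z(1)] tuple_le_if_le by blast
        then obtain r where r: "r \<in> U b" "(r, tuple_class n v) \<in> ?le"
          using p unfolding dense_below_def by blast
        then have "r \<in> Field ?le" by (auto simp: Field_def)
        then obtain w where w: "inf_sets w" "r = tuple_class n w" by (rule Field_P_fin_powerE)
        show False
          using r v(3)[OF w(1)] in_U[OF w(1) b] tuple_class_le_iff[OF w(1) v(1)] w(2) by blast
      qed
    qed
    then show ?thesis
      using op by (auto simp: regular_opens_def
          interior_closure_poset_topology[OF P_fin_power_refl P_fin_power_trans])
  qed
  let ?A = "\<lambda>\<beta>. U ` B \<beta>"
  have "\<forall>\<beta>\<in>?K. ?A \<beta> \<subseteq> regular_opens ?X" using U B by blast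
  then have eq: "ro_Inf ?X {ro_Sup ?X (?A \<beta>) | \<beta>. \<beta> \<in> ?K} =
      ro_Sup ?X {ro_Inf ?X (f ` ?K) | f. \<forall>\<beta>\<in>?K. f \<beta> \<in> ?A \<beta>}"
    by (rule mp[OF spec[OF distr[unfolded ro_distributive_def Let_def]]])
  have sup: "p \<in> ro_Sup ?X (?A \<beta>)" if \<beta>: "\<beta> \<in> ?K" and p: "p \<in> Field ?le" for \<beta> p
    unfolding inS dense_below_def
  proof (intro conjI allI impI)
    show "p \<in> Field ?le" by (rule p)
    fix q assume "(q, p) \<in> ?le"
    then have "q \<in> Field ?le" by (auto simp: Field_def)
    then obtain z where z: "inf_sets z" "q = tuple_class n z" by (rule Field_P_fin_powerE)
    obtain y b where y: "inf_sets y" "tuple_le n y z" "b \<in> B \<beta>" "tuple_le n y b"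
      using dense[OF \<beta> z(1)] unfolding tuple_below_def by blast
    then have "tuple_class n y \<in> U b" using in_U B \<beta> by blast
    moreover have "(tuple_class n y, q) \<in> ?le" using y z tuple_class_le_iff by blast
    ultimately show "\<exists>r\<in>\<Union>(?A \<beta>). (r, q) \<in> ?le" using y by blast
  qed
  have xF: "tuple_class n x \<in> Field ?le" using x by (rule tuple_class_in_Field)
  have inF: "q \<in> Field ?le" if "(q, p) \<in> ?le" for p q
    using that by (auto simp: Field_def)
  have "tuple_class n x \<in> ro_Inf ?X {ro_Sup ?X (?A \<beta>) | \<beta>. \<beta> \<in> ?K}"
    unfolding inI using xF sup inF by blast
  then have "dense_below ?le (\<Union>{ro_Inf ?X (f ` ?K) | f. \<forall>\<beta>\<in>?K. f \<beta> \<in> ?A \<beta>}) (tuple_class n x)"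
    unfolding eq inS by blast
  moreover have "(tuple_class n x, tuple_class n x) \<in> ?le"
    using xF P_fin_power_refl by (rule refl_onD[rotated])
  ultimately obtain r f where r: "(r, tuple_class n x) \<in> ?le"
      "r \<in> ro_Inf ?X (f ` ?K)" "\<forall>\<beta>\<in>?K. f \<beta> \<in> ?A \<beta>"
    unfolding dense_below_def by blast
  have rF: "r \<in> Field ?le" using r(1) by (rule inF)
  then obtain y where y: "inf_sets y" "r = tuple_class n y" by (rule Field_P_fin_powerE)
  have "(r, r) \<in> ?le" using rF P_fin_power_refl by (rule refl_onD[rotated])
  then have "r \<in> f \<beta>" if "\<beta> \<in> ?K" for \<beta> using r(2) that unfolding inI by blast
  then have "tuple_below n (B \<beta>) y" if "\<beta> \<in> ?K" for \<beta>
    using r(3) that y in_U[OF y(1) B] unfolding tuple_below_def by blast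
  moreover have "tuple_le n y x" using r(1) y tuple_class_le_iff[OF y(1) x] by blast
  ultimately show ?thesis using y(1) by blast
qed

section \<open>Splitting families of infinite sets along a matrix of antichains\<close>

text \<open>In the manner of a base matrix, except that the levels need not refine one another.
  \<open>no_common\<close> records the failure of distributivity at \<open>\<kappa>\<close>,
  \<open>level_dense\<close> its validity for initial segments.\<close>

locale tuple_matrix =
  fixes n :: nat and \<kappa> :: "'k rel" and B :: "'k \<Rightarrow> (nat \<Rightarrow> nat set) set"
  assumes wo: "Well_order \<kappa>"
    and antichain: "\<beta> \<in> Field \<kappa> \<Longrightarrow> tuple_antichain n (B \<beta>)"
    and no_common: "inf_sets x \<Longrightarrow> \<exists>\<beta>\<in>Field \<kappa>. \<not> tuple_below n (B \<beta>) x"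
    and level_dense: "\<alpha> \<in> Field \<kappa> \<Longrightarrow> inf_sets x \<Longrightarrow>
      \<exists>y. inf_sets y \<and> tuple_le n y x \<and> (\<forall>\<beta>\<in>under \<kappa> \<alpha>. tuple_below n (B \<beta>) y)"
begin

section \<open>The index set and its cofinality\<close>

lemma self_in_under: "\<alpha> \<in> Field \<kappa> \<Longrightarrow> \<alpha> \<in> under \<kappa> \<alpha>"
  using wo by (auto simp: under_def order_on_defs dest: refl_onD)

lemma under_Field: "\<beta> \<in> under \<kappa> \<alpha> \<Longrightarrow> \<beta> \<in> Field \<kappa>"
  by (auto simp: under_def Field_def)

lemma under_linear: "\<alpha> \<in> Field \<kappa> \<Longrightarrow> \<beta> \<in> Field \<kappa> \<Longrightarrow> \<alpha> \<in> under \<kappa> \<beta> \<or> \<beta> \<in> under \<kappa> \<alpha>"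
  using wo self_in_under[of \<alpha>] by (auto simp: under_def order_on_defs total_on_def)

lemma antichain_unique:
  assumes "\<beta> \<in> Field \<kappa>" "b \<in> B \<beta>" "b' \<in> B \<beta>" "inf_sets z" "tuple_le n z b" "tuple_le n z b'"
  shows "b = b'"
  using antichain[OF assms(1)] assms(2-) unfolding tuple_antichain_def by blast

text \<open>By \<sigma>-closure some \<open>x\<close> lies below members of all antichains indexed
  up to any element of \<open>C\<close>. An index \<open>\<alpha>\<close> whose antichain has no
  member above \<open>x\<close> must then lie above all of \<open>C\<close>.\<close>

lemma countable_bounded:
  assumes "countable C" "C \<subseteq> Field \<kappa>"
  shows "\<exists>\<alpha>\<in>Field \<kappa>. C \<subseteq> under \<kappa> \<alpha>"
\<comment> \<open>\<open>from_nat_into\<close> enumerates only nonempty sets; for empty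
  \<open>C\<close> it is enough that \<open>no_common\<close> supplies some index.\<close>
proof (cases "C = {}")
  case True
  moreover have "inf_sets (\<lambda>_::nat. UNIV)" by (simp add: inf_sets_def)
  ultimately show ?thesis using no_common by blast
next
  case False
  let ?c = "from_nat_into C"
  have cC: "?c i \<in> C" for i using False by (rule from_nat_into)
  then have cF: "?c i \<in> Field \<kappa>" for i using assms(2) by blast
  let ?P = "\<lambda>i x. \<forall>\<beta>\<in>under \<kappa> (?c i). tuple_below n (B \<beta>) x"
  have "\<exists>Y. inf_sets Y \<and> Y \<le> (\<lambda>_. UNIV) \<and> (\<forall>i. ?P i Y)"
  proof (rule countable_shrinking)
    show "?P i Y" if "?P i X" "almost_subsets Y X" for i X Y
      using that tuple_below_mono tuple_le_if_almost_subsets by blast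
    show "\<exists>Y. inf_sets Y \<and> Y \<le> X \<and> ?P i Y" if X: "inf_sets X" for i X
    proof -
      obtain y where y: "inf_sets y" "tuple_le n y X" "?P i y"
        using level_dense[OF cF X] by blast
      define Y where "Y j = (if j < n then X j \<inter> y j else X j)" for j
      have "infinite (X j \<inter> y j)" if "j < n" for j
      proof
        assume "finite (X j \<inter> y j)"
        moreover have "finite (y j - X j)" using y(2) that by (simp add: tuple_le_def)
        ultimately have "finite ((X j \<inter> y j) \<union> (y j - X j))" by simp
        then have "finite (y j)" by (rule rev_finite_subset) blast
        then show False using y(1) by (simp add: inf_sets_def)
      qed
      then have "inf_sets Y" using X by (simp add: inf_sets_def Y_def)
      moreover have "Y \<le> X" by (auto simp: Y_def le_fun_def)
      moreover have "tuple_le n Y y" by (simp add: tuple_le_def Y_def Int_commute Diff_eq_empty_iff[THEN iffD2])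
      ultimately show ?thesis using y(3) tuple_below_mono by blast
    qed
    show "inf_sets (\<lambda>_::nat. UNIV)" by (simp add: inf_sets_def)
  qed
  then obtain x where x: "inf_sets x" "\<And>i. ?P i x" by blast
  obtain \<alpha> where \<alpha>: "\<alpha> \<in> Field \<kappa>" "\<not> tuple_below n (B \<alpha>) x" using no_common[OF x(1)] by blast
  have "\<gamma> \<in> under \<kappa> \<alpha>" if \<gamma>: "\<gamma> \<in> C" for \<gamma>
  proof -
    obtain i where "?c i = \<gamma>" using from_nat_into_surj[OF assms(1) \<gamma>] by blast
    then have "\<alpha> \<notin> under \<kappa> \<gamma>" using x(2)[of i] \<alpha>(2) by blast
    then show ?thesis using under_linear \<alpha>(1) \<gamma> assms(2) by blast
  qed
  then show ?thesis using \<alpha>(1) by blast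
qed

text \<open>A finite field would have a largest index, and \<open>level_dense\<close> there would
  contradict \<open>no_common\<close>.\<close>

lemma infinite_Field: "infinite (Field \<kappa>)"
proof
  assume "finite (Field \<kappa>)"
  then obtain \<alpha> where \<alpha>: "\<alpha> \<in> Field \<kappa>" "Field \<kappa> \<subseteq> under \<kappa> \<alpha>"
    using countable_bounded[of "Field \<kappa>"] countable_finite by blast
  have "inf_sets (\<lambda>_::nat. UNIV)" by (simp add: inf_sets_def)
  then obtain y where "inf_sets y" "\<forall>\<beta>\<in>under \<kappa> \<alpha>. tuple_below n (B \<beta>) y"
    using level_dense[OF \<alpha>(1)] by blast
  then show False using no_common \<alpha>(2) by blast
qed

section \<open>Separation of tuples and of whole families\<close>

definition separated :: "'k \<Rightarrow> (nat \<Rightarrow> nat set) \<Rightarrow> (nat \<Rightarrow> nat set) \<Rightarrow> bool" where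
  "separated \<beta> x y \<longleftrightarrow> (\<exists>b\<in>B \<beta>. \<exists>b'\<in>B \<beta>. b \<noteq> b' \<and> tuple_le n x b \<and> tuple_le n y b')"

lemma separated_mono:
  "separated \<beta> x y \<Longrightarrow> tuple_le n x' x \<Longrightarrow> tuple_le n y' y \<Longrightarrow> separated \<beta> x' y'"
  unfolding separated_def using tuple_le_trans by blast

lemma below_dense:
  assumes "\<beta> \<in> Field \<kappa>" "inf_sets x"
  shows "\<exists>y. inf_sets y \<and> tuple_le n y x \<and> tuple_below n (B \<beta>) y"
  using level_dense[OF assms] self_in_under[OF assms(1)] by blast

text \<open>Choose a level \<open>\<beta>\<close> with no member above \<open>u\<close>, and let
  \<open>v'\<close> lie below a member \<open>b'\<close> of it. By separativity \<open>u\<close> has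
  an extension incompatible with \<open>b'\<close>; any member reached from there differs from
  \<open>b'\<close>.\<close>

lemma separate_tuples:
  assumes u: "inf_sets u" and v: "inf_sets v"
  shows "\<exists>\<beta>\<in>Field \<kappa>. \<exists>u' v'. inf_sets u' \<and> inf_sets v' \<and> tuple_le n u' u \<and> tuple_le n v' v \<and>
    separated \<beta> u' v'"
proof -
  obtain \<beta> where \<beta>: "\<beta> \<in> Field \<kappa>" "\<not> tuple_below n (B \<beta>) u" using no_common[OF u] by blast
  obtain v' b' where v': "inf_sets v'" "tuple_le n v' v" "b' \<in> B \<beta>" "tuple_le n v' b'"
    using below_dense[OF \<beta>(1) v] unfolding tuple_below_def by blast
  then have "\<not> tuple_le n u b'" using \<beta>(2) unfolding tuple_below_def by blast
  then obtain w where w: "inf_sets w" "w \<le> u"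
    "\<And>z. inf_sets z \<Longrightarrow> tuple_le n z w \<Longrightarrow> \<not> tuple_le n z b'"
    using tuple_separative[OF u] by blast
  obtain u' b where u': "inf_sets u'" "tuple_le n u' w" "b \<in> B \<beta>" "tuple_le n u' b"
    using below_dense[OF \<beta>(1) w(1)] unfolding tuple_below_def by blast
  have "b \<noteq> b'" using w(3)[OF u'(1,2)] u'(4) by blast
  then have "separated \<beta> u' v'" using u' v' unfolding separated_def by blast
  moreover have "tuple_le n u' u" using tuple_le_trans[OF u'(2) tuple_le_if_le[OF w(2)]] .
  ultimately show ?thesis using \<beta>(1) u'(1) v'(1,2) by blast
qed

text \<open>Both halves are treated as one family indexed by \<open>bool \<times> 'e\<close>, so
  that a single application of \<open>countable_shrinking\<close>, with the lists \<open>t\<close>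
  as requirements, shrinks them simultaneously.\<close>

lemma split_family:
  fixes X :: "'e::countable \<Rightarrow> nat set"
  assumes X: "inf_sets X"
  shows "\<exists>S. (\<forall>b. inf_sets (S b) \<and> S b \<le> X) \<and> (\<forall>t. distinct t \<and> length t = n \<longrightarrow>
    (\<exists>\<beta>\<in>Field \<kappa>. separated \<beta> (tuple_of (S True) t) (tuple_of (S False) t)))"
proof -
  let ?h = "\<lambda>(W :: bool \<times> 'e \<Rightarrow> nat set) b e. W (b, e)"
  let ?P = "\<lambda>t W. distinct t \<and> length t = n \<longrightarrow>
    (\<exists>\<beta>\<in>Field \<kappa>. separated \<beta> (tuple_of (?h W True) t) (tuple_of (?h W False) t))"
  have "\<exists>Y. inf_sets Y \<and> Y \<le> (\<lambda>(_, e). X e) \<and> (\<forall>t. ?P t Y)"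
  proof (rule countable_shrinking)
    show "?P t W'" if P: "?P t W" and le: "almost_subsets W' W" for t W W'
    proof -
      have "tuple_le n (tuple_of (?h W' b) t) (tuple_of (?h W b) t)" for b
        using le by (intro tuple_of_almost_subsets) (simp add: almost_subsets_def)
      then show ?thesis using P separated_mono by blast
    qed
    show "\<exists>W'. inf_sets W' \<and> W' \<le> W \<and> ?P t W'" if W: "inf_sets W" for t W
    proof (cases "distinct t \<and> length t = n")
      case True
      then have t: "distinct t" "length t = n" by blast+
      have inf: "inf_sets (?h W b)" for b using W by (simp add: inf_sets_def)
      obtain \<beta> u v where \<beta>: "\<beta> \<in> Field \<kappa>" "separated \<beta> u v" and u: "inf_sets u" "inf_sets v"
        "tuple_le n u (tuple_of (?h W True) t)" "tuple_le n v (tuple_of (?h W False) t)"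
        using separate_tuples[OF inf_sets_tuple_of[OF inf] inf_sets_tuple_of[OF inf]] by blast
      obtain U where U: "inf_sets U" "U \<le> ?h W True" "tuple_le n (tuple_of U t) u"
        using shrink_tuple_of[OF inf t u(1,3)] by blast
      obtain V where V: "inf_sets V" "V \<le> ?h W False" "tuple_le n (tuple_of V t) v"
        using shrink_tuple_of[OF inf t u(2,4)] by blast
      define W' where "W' = (\<lambda>(b, e). if b then U e else V e)"
      have h: "?h W' True = U" "?h W' False = V" by (simp_all add: W'_def)
      have "inf_sets W'" using U(1) V(1) by (simp add: inf_sets_def W'_def)
      moreover have "W' \<le> W" using U(2) V(2) by (auto simp: le_fun_def W'_def)
      moreover have "separated \<beta> (tuple_of U t) (tuple_of V t)"
        using separated_mono[OF \<beta>(2) U(3) V(3)] .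
      ultimately show ?thesis using \<beta>(1) h by (intro exI[of _ W']) auto
    next
      case False
      then show ?thesis using W by (intro exI[of _ W]) auto
    qed
    show "inf_sets (\<lambda>(_ :: bool, e). X e)" using X by (simp add: inf_sets_def)
  qed
  then obtain W where W: "inf_sets W" "W \<le> (\<lambda>(_, e). X e)" "\<And>t. ?P t W" by blast
  have "inf_sets (?h W b) \<and> ?h W b \<le> X" for b
    using W(1,2) by (auto simp: inf_sets_def le_fun_def)
  then show ?thesis using W(3) by (intro exI[of _ "?h W"]) blast
qed

lemma level_family:
  fixes X :: "'e::countable \<Rightarrow> nat set"
  assumes \<alpha>: "\<alpha> \<in> Field \<kappa>" and X: "inf_sets X"
  shows "\<exists>Y. inf_sets Y \<and> Y \<le> X \<and> (\<forall>t. distinct t \<and> length t = n \<longrightarrow>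
    (\<forall>\<beta>\<in>under \<kappa> \<alpha>. tuple_below n (B \<beta>) (tuple_of Y t)))"
proof (rule countable_shrinking[OF _ _ X])
  let ?P = "\<lambda>t W. distinct t \<and> length t = n \<longrightarrow>
    (\<forall>\<beta>\<in>under \<kappa> \<alpha>. tuple_below n (B \<beta>) (tuple_of W t))"
  show "?P t W'" if "?P t W" "almost_subsets W' W" for t and W W' :: "'e \<Rightarrow> nat set"
    using that(1) tuple_below_mono tuple_of_almost_subsets[OF that(2)] by blast
  show "\<exists>W'. inf_sets W' \<and> W' \<le> W \<and> ?P t W'" if W: "inf_sets W" for t and W :: "'e \<Rightarrow> nat set"
  proof (cases "distinct t \<and> length t = n")
    case True
    then have t: "distinct t" "length t = n" by blast+
    obtain y where y: "inf_sets y" "tuple_le n y (tuple_of W t)"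
      "\<forall>\<beta>\<in>under \<kappa> \<alpha>. tuple_below n (B \<beta>) y"
      using level_dense[OF \<alpha> inf_sets_tuple_of[OF W]] by blast
    obtain W' where W': "inf_sets W'" "W' \<le> W" "tuple_le n (tuple_of W' t) y"
      using shrink_tuple_of[OF W t y(1,2)] by blast
    then have "?P t W'" using y(3) tuple_below_mono by blast
    then show ?thesis using W' by (intro exI[of _ W']) simp
  next
    case False
    then show ?thesis using W by (intro exI[of _ W]) auto
  qed
qed

section \<open>Codes of tuples on a level\<close>

text \<open>Being a relation, it makes sense for every \<open>x\<close>; it is the graph of a
  function on \<open>under \<kappa> \<alpha>\<close> once an \<open>x\<close> with
  \<open>inf_sets x\<close> lies below a member of each antichain up to
  \<open>\<alpha>\<close>.\<close>

definition code :: "'k \<Rightarrow> (nat \<Rightarrow> nat set) \<Rightarrow> ('k \<times> (nat \<Rightarrow> nat set)) set" where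
  "code \<alpha> x = {(\<beta>, b). \<beta> \<in> under \<kappa> \<alpha> \<and> b \<in> B \<beta> \<and> tuple_le n x b}"

text \<open>\<open>z\<close> inherits all members above \<open>x\<close>, and by the antichain
  property it can lie below no others.\<close>

lemma code_eq_if_le:
  assumes x: "\<forall>\<beta>\<in>under \<kappa> \<alpha>. tuple_below n (B \<beta>) x" and z: "inf_sets z" "tuple_le n z x"
  shows "code \<alpha> z = code \<alpha> x"
proof
  show "code \<alpha> x \<subseteq> code \<alpha> z" unfolding code_def using tuple_le_trans[OF z(2)] by blast
  show "code \<alpha> z \<subseteq> code \<alpha> x"
  proof
    fix c assume "c \<in> code \<alpha> z"
    then obtain \<beta> b where c: "c = (\<beta>, b)" "\<beta> \<in> under \<kappa> \<alpha>" "b \<in> B \<beta>" "tuple_le n z b"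
      by (auto simp: code_def)
    obtain b' where b': "b' \<in> B \<beta>" "tuple_le n x b'" using x c(2) unfolding tuple_below_def by blast
    have "b = b'"
      using antichain_unique[OF under_Field[OF c(2)] c(3) b'(1) z(1) c(4) tuple_le_trans[OF z(2) b'(2)]] .
    then show "c \<in> code \<alpha> x" using c b' by (simp add: code_def)
  qed
qed

lemma code_neq_if_separated:
  assumes "\<beta> \<in> under \<kappa> \<alpha>" "separated \<beta> x y" "inf_sets y"
  shows "code \<alpha> x \<noteq> code \<alpha> y"
proof
  assume eq: "code \<alpha> x = code \<alpha> y"
  obtain b b' where b: "b \<in> B \<beta>" "b' \<in> B \<beta>" "b \<noteq> b'" "tuple_le n x b" "tuple_le n y b'"
    using assms(2) unfolding separated_def by blast
  have "(\<beta>, b) \<in> code \<alpha> x" using assms(1) b by (simp add: code_def)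
  then have "tuple_le n y b" unfolding eq by (simp add: code_def)
  then show False using antichain_unique[OF under_Field[OF assms(1)] b(1,2) assms(3)] b by blast
qed

text \<open>Iterating \<open>split_family\<close> gives a binary tree of families in which only
  countably many separation levels occur, so some \<open>\<alpha>\<close> bounds them. Families
  along two branches are then separated, and hence have different codes on level
  \<open>\<alpha>\<close>, at every tuple.\<close>

lemma continuum_many_codes:
  fixes X :: "'e::countable \<Rightarrow> nat set"
  assumes X: "inf_sets X"
  shows "\<exists>\<alpha>\<in>Field \<kappa>. \<exists>Y :: (nat \<Rightarrow> bool) \<Rightarrow> 'e \<Rightarrow> nat set.
    (\<forall>f. inf_sets (Y f) \<and> Y f \<le> X) \<and>
    (\<forall>t. distinct t \<and> length t = n \<longrightarrow>
      (\<forall>f. \<forall>\<beta>\<in>under \<kappa> \<alpha>. tuple_below n (B \<beta>) (tuple_of (Y f) t)) \<and>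
      inj (\<lambda>f. code \<alpha> (tuple_of (Y f) t)))"
proof -
  have "\<forall>W :: 'e \<Rightarrow> nat set. \<exists>S. inf_sets W \<longrightarrow> (\<forall>b. inf_sets (S b) \<and> S b \<le> W) \<and>
    (\<forall>t. distinct t \<and> length t = n \<longrightarrow>
      (\<exists>\<beta>\<in>Field \<kappa>. separated \<beta> (tuple_of (S True) t) (tuple_of (S False) t)))"
  proof
    fix W :: "'e \<Rightarrow> nat set"
    show "\<exists>S. inf_sets W \<longrightarrow> (\<forall>b. inf_sets (S b) \<and> S b \<le> W) \<and>
      (\<forall>t. distinct t \<and> length t = n \<longrightarrow>
        (\<exists>\<beta>\<in>Field \<kappa>. separated \<beta> (tuple_of (S True) t) (tuple_of (S False) t)))"
      using split_family[of W] by (cases "inf_sets W") simp_all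
  qed
  then obtain S :: "('e \<Rightarrow> nat set) \<Rightarrow> bool \<Rightarrow> 'e \<Rightarrow> nat set"
    where S_all: "\<forall>W. inf_sets W \<longrightarrow> (\<forall>b. inf_sets (S W b) \<and> S W b \<le> W) \<and>
      (\<forall>t. distinct t \<and> length t = n \<longrightarrow>
        (\<exists>\<beta>\<in>Field \<kappa>. separated \<beta> (tuple_of (S W True) t) (tuple_of (S W False) t)))"
    by (rule choice[THEN exE])
  have S: "inf_sets (S W b)" "S W b \<le> W" if "inf_sets W" for W b
    using S_all that by simp_all
  have S_sep: "\<exists>\<beta>\<in>Field \<kappa>. separated \<beta> (tuple_of (S W True) t) (tuple_of (S W False) t)"
    if "inf_sets W" "distinct t" "length t = n" for W t
    using S_all that by simp
  \<comment> \<open>\<open>T s\<close> is the family at node \<open>s\<close> of the binary tree.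
    Lists grow at the head, so \<open>s\<close> records its path backwards, and
    \<open>pre f m\<close> is the reversal of the first \<open>m\<close> values of
    \<open>f\<close>.\<close>
  define T where "T = rec_list X (\<lambda>b s W. S W b)"
  have T: "T [] = X" "T (b # s) = S (T s) b" for b s by (simp_all add: T_def)
  have T_inf: "inf_sets (T s)" for s by (induction s) (simp_all add: T X S(1))
  \<comment> \<open>A level on which the two children of \<open>s\<close> are separated at the tuple
    \<open>t\<close>; there are countably many pairs of such lists.\<close>
  define \<beta> where "\<beta> s t = (SOME \<beta>. \<beta> \<in> Field \<kappa> \<and>
    separated \<beta> (tuple_of (T (True # s)) t) (tuple_of (T (False # s)) t))" for s t
  have \<beta>_all: "\<beta> s t \<in> Field \<kappa> \<and>
      separated (\<beta> s t) (tuple_of (T (True # s)) t) (tuple_of (T (False # s)) t)"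
    if "distinct t" "length t = n" for s t
  proof -
    have "\<exists>\<beta>. \<beta> \<in> Field \<kappa> \<and>
        separated \<beta> (tuple_of (T (True # s)) t) (tuple_of (T (False # s)) t)"
      using S_sep[OF T_inf that, of s] unfolding T(2) by (elim bexE) (intro exI conjI)
    from someI_ex[OF this] show ?thesis unfolding \<beta>_def .
  qed
  have \<beta>: "\<beta> s t \<in> Field \<kappa>"
      "separated (\<beta> s t) (tuple_of (T (True # s)) t) (tuple_of (T (False # s)) t)"
    if "distinct t" "length t = n" for s t
    using \<beta>_all[OF that] by simp_all
  let ?C = "{\<beta> s t | s t. distinct t \<and> length t = n}"
  have "?C \<subseteq> range (case_prod \<beta>)" by auto
  then have "countable ?C" by (rule countable_subset) simp
  moreover have "?C \<subseteq> Field \<kappa>" using \<beta>(1) by blast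
  ultimately have "\<exists>\<alpha>\<in>Field \<kappa>. ?C \<subseteq> under \<kappa> \<alpha>" by (rule countable_bounded)
  then obtain \<alpha> where \<alpha>: "\<alpha> \<in> Field \<kappa>" "?C \<subseteq> under \<kappa> \<alpha>" by (elim bexE)
  define pre where "pre f = rec_nat [] (\<lambda>m s. f m # s)" for f :: "nat \<Rightarrow> bool"
  have pre: "pre f 0 = []" "pre f (Suc m) = f m # pre f m" for f m by (simp_all add: pre_def)
  have "\<forall>f. \<exists>Y. inf_sets Y \<and> Y \<le> X \<and> (\<forall>m. almost_subsets Y (T (pre f m))) \<and>
    (\<forall>t. distinct t \<and> length t = n \<longrightarrow>
      (\<forall>\<beta>\<in>under \<kappa> \<alpha>. tuple_below n (B \<beta>) (tuple_of Y t)))"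
  proof
    fix f
    have "T (pre f (Suc m)) \<le> T (pre f m)" for m unfolding pre T(2) by (rule S(2)[OF T_inf])
    then obtain Z where Z: "inf_sets Z" "Z \<le> X" "\<forall>m. almost_subsets Z (T (pre f m))"
      using decreasing_families_pseudointersection[of "\<lambda>m. T (pre f m)", OF T_inf] pre(1) T(1)
      by auto
    \<comment> \<open>A second shrinking puts every tuple below members of all antichains up to
      \<open>\<alpha>\<close>, as \<open>code_eq_if_le\<close> requires.\<close>
    obtain Y where Y: "inf_sets Y" "Y \<le> Z" "\<forall>t. distinct t \<and> length t = n \<longrightarrow>
      (\<forall>\<beta>\<in>under \<kappa> \<alpha>. tuple_below n (B \<beta>) (tuple_of Y t))"
      using level_family[OF \<alpha>(1) Z(1)] by blast
    have "almost_subsets Y (T (pre f m))" for m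
      unfolding almost_subsets_def
    proof
      fix e
      have "finite (Z e - T (pre f m) e)" using Z(3) by (simp add: almost_subsets_def)
      then show "finite (Y e - T (pre f m) e)"
        by (rule rev_finite_subset) (use Y(2) in \<open>auto simp: le_fun_def\<close>)
    qed
    moreover have "Y \<le> X" using Y(2) Z(2) by (rule order_trans)
    ultimately show "\<exists>Y. inf_sets Y \<and> Y \<le> X \<and> (\<forall>m. almost_subsets Y (T (pre f m))) \<and>
      (\<forall>t. distinct t \<and> length t = n \<longrightarrow>
        (\<forall>\<beta>\<in>under \<kappa> \<alpha>. tuple_below n (B \<beta>) (tuple_of Y t)))"
      using Y(1,3) by (intro exI[of _ Y]) simp
  qed
  then obtain Y where Y_all: "\<forall>f. inf_sets (Y f) \<and> Y f \<le> X \<and>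
      (\<forall>m. almost_subsets (Y f) (T (pre f m))) \<and> (\<forall>t. distinct t \<and> length t = n \<longrightarrow>
        (\<forall>\<beta>\<in>under \<kappa> \<alpha>. tuple_below n (B \<beta>) (tuple_of (Y f) t)))"
    by (rule choice[THEN exE])
  have Y: "inf_sets (Y f)" "Y f \<le> X" "almost_subsets (Y f) (T (pre f m))" for f m
    using Y_all by simp_all
  have neq: "code \<alpha> (tuple_of (Y f) t) \<noteq> code \<alpha> (tuple_of (Y g) t)"
    if t: "distinct t" "length t = n" and fg: "f m" "\<not> g m" "pre f m = pre g m" for t f g m
  proof (rule code_neq_if_separated)
    show "\<beta> (pre f m) t \<in> under \<kappa> \<alpha>" by (rule subsetD[OF \<alpha>(2)]) (use t in blast)
    show "inf_sets (tuple_of (Y g) t)" using Y(1) by (rule inf_sets_tuple_of)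
    have "almost_subsets (Y f) (T (True # pre f m))" "almost_subsets (Y g) (T (False # pre f m))"
      using Y(3)[of f "Suc m"] Y(3)[of g "Suc m"] fg by (simp_all add: pre)
    then show "separated (\<beta> (pre f m) t) (tuple_of (Y f) t) (tuple_of (Y g) t)"
      using separated_mono[OF \<beta>(2)[OF t]] tuple_of_almost_subsets by blast
  qed
  have "inj (\<lambda>f. code \<alpha> (tuple_of (Y f) t))" if t: "distinct t" "length t = n" for t
  proof (rule injI, rule ccontr)
    fix f g assume eq: "code \<alpha> (tuple_of (Y f) t) = code \<alpha> (tuple_of (Y g) t)" and "f \<noteq> g"
    then have ex: "\<exists>m. f m \<noteq> g m" by blast
    \<comment> \<open>At the first difference the branches leave a common node in opposite
      directions.\<close>
    define m where "m = (LEAST m. f m \<noteq> g m)"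
    have m: "f m \<noteq> g m" unfolding m_def using ex by (rule LeastI_ex)
    have less: "f k = g k" if "k < m" for k using that not_less_Least unfolding m_def by blast
    have "pre f k = pre g k" if "k \<le> m" for k
      using that by (induction k) (simp_all add: pre less)
    then show False
      using neq[OF t, of f m g] neq[OF t, of g m f] eq m by (cases "f m") auto
  qed
  then show ?thesis using \<alpha>(1) Y_all by (intro bexI[of _ \<alpha>] exI[of _ Y]) auto
qed

end

text \<open>The failure of distributivity at h(n) supplies the antichains. A proper initial segment
  has smaller cardinality, so by minimality the law holds for it and yields common
  refinements.\<close>

lemma h_number_tuple_matrix:
  assumes "0 < n"
  shows "\<exists>B. tuple_matrix n (h_number n) B"
proof -
  let ?\<kappa> = "h_number n"
  have card: "Card_order ?\<kappa>" and nd: "\<not> ro_distributive ?\<kappa> (P_fin_power n)"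
    and least: "\<And>\<mu> :: nat set rel. Card_order \<mu> \<Longrightarrow> \<not> ro_distributive \<mu> (P_fin_power n) \<Longrightarrow>
      (?\<kappa>, \<mu>) \<in> ordLeq"
    using h_number[OF assms] unfolding is_h_number_def by blast+
  obtain B where B: "\<forall>\<alpha>\<in>Field ?\<kappa>. tuple_antichain n (B \<alpha>)"
    and dense: "\<forall>\<alpha>\<in>Field ?\<kappa>. \<forall>x. inf_sets x \<longrightarrow>
      (\<exists>y. inf_sets y \<and> tuple_le n y x \<and> tuple_below n (B \<alpha>) y)"
    and no: "\<forall>x. inf_sets x \<longrightarrow> (\<exists>\<alpha>\<in>Field ?\<kappa>. \<not> tuple_below n (B \<alpha>) x)"
    using not_ro_distributive_antichains[OF nd] by (elim exE conjE)
  have "tuple_matrix n ?\<kappa> B"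
  proof
    show "Well_order ?\<kappa>" using card by (simp add: card_order_on_def)
    show "tuple_antichain n (B \<beta>)" if "\<beta> \<in> Field ?\<kappa>" for \<beta> using B that by blast
    show "\<exists>\<beta>\<in>Field ?\<kappa>. \<not> tuple_below n (B \<beta>) x" if "inf_sets x" for x using no that by blast
    fix \<alpha> and x :: "nat \<Rightarrow> nat set" assume \<alpha>: "\<alpha> \<in> Field ?\<kappa>" and x: "inf_sets x"
    \<comment> \<open>The field of this cardinal is the segment itself, so the antichains keep their
      indices.\<close>
    let ?\<mu> = "card_of (underS ?\<kappa> \<alpha>)"
    have "(?\<mu>, ?\<kappa>) \<in> ordLess" using card_of_underS[OF card \<alpha>] .
    then have "(?\<kappa>, ?\<mu>) \<notin> ordLeq" by (rule not_ordLess_ordLeq)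
    then have distr: "ro_distributive ?\<mu> (P_fin_power n)"
      using least card_of_Card_order by blast
    have sub: "\<beta> \<in> Field ?\<kappa>" if "\<beta> \<in> Field ?\<mu>" for \<beta>
      using that unfolding Field_card_of by (auto simp: underS_def Field_def)
    have "\<exists>y. inf_sets y \<and> tuple_le n y x \<and> (\<forall>\<beta>\<in>Field ?\<mu>. tuple_below n (B \<beta>) y)"
      by (rule ro_distributive_common_refinement[OF distr _ _ x])
        (use sub B dense tuple_antichain_def in blast)+
    then obtain y where y: "inf_sets y" "tuple_le n y x"
      "\<And>\<beta>. \<beta> \<in> underS ?\<kappa> \<alpha> \<Longrightarrow> tuple_below n (B \<beta>) y"
      unfolding Field_card_of by blast
    \<comment> \<open>Distributivity treats the indices strictly below \<open>\<alpha>\<close>; one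
      more refinement treats \<open>\<alpha>\<close>.\<close>
    obtain z where z: "inf_sets z" "tuple_le n z y" "tuple_below n (B \<alpha>) z"
      using dense \<alpha> y(1) by blast
    have "tuple_below n (B \<beta>) z" if "\<beta> \<in> under ?\<kappa> \<alpha>" for \<beta>
      using that z y(3)[of \<beta>] tuple_below_mono by (cases "\<beta> = \<alpha>") (auto simp: under_def underS_def)
    then show "\<exists>y. inf_sets y \<and> tuple_le n y x \<and> (\<forall>\<beta>\<in>under ?\<kappa> \<alpha>. tuple_below n (B \<beta>) y)"
      using z tuple_le_trans[OF z(2) y(2)] by blast
  qed
  then show ?thesis by blast
qed

section \<open>Selection of pairwise incompatible conditions\<close>

text \<open>Recursion along a cardinal well-order of \<open>'j\<close>: fewer than
  \<open>|'j|\<close> choices precede each stage and each of them excludes countably many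
  \<open>f\<close>, so some \<open>f\<close> remains.\<close>

lemma greedy_selection:
  fixes conflict :: "'j \<Rightarrow> 'f \<Rightarrow> 'j \<Rightarrow> 'f \<Rightarrow> bool"
  assumes small: "|UNIV :: 'j set| \<le>o |UNIV :: 'f set|"
    and unc: "uncountable (UNIV :: 'f set)"
    and sym: "\<And>j j' f g. conflict j f j' g \<Longrightarrow> conflict j' g j f"
    and cnt: "\<And>j j' g. countable {f. conflict j f j' g}"
  shows "\<exists>F. \<forall>j j'. j \<noteq> j' \<longrightarrow> \<not> conflict j (F j) j' (F j')"
proof -
  let ?R = "|UNIV :: 'j set|"
  have wo: "Well_order ?R" by (rule card_of_Well_order)
  have FR: "Field ?R = UNIV" by (rule Field_card_of)
  have wf: "wf (?R - Id)" using wo by (simp add: well_order_on_def)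
  let ?P = "\<lambda>F j f. \<forall>j'. (j', j) \<in> ?R - Id \<longrightarrow> \<not> conflict j f j' (F j')"
  have "\<exists>F. \<forall>j. ?P F j (F j)"
  proof (rule dependent_wf_choice[OF wf])
    show "?P F j f = ?P G j f" if "\<And>z. (z, j) \<in> ?R - Id \<Longrightarrow> F z = G z" for F G j f
      using that by metis
    fix j F
    let ?A = "underS ?R j"
    let ?bad = "\<Union>j'\<in>?A. {f. conflict j f j' (F j')}"
    have A: "|?A| <o ?R" by (rule card_of_underS[OF card_of_Card_order]) (simp add: FR)
    have "?bad \<noteq> UNIV"
    \<comment> \<open>After finitely many stages the bad set is countable, and uncountability of
      \<open>'f\<close> suffices. After infinitely many, the countable sets are absorbed into the
      cardinality of \<open>?A\<close>.\<close>
    proof (cases "finite ?A")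
      case True
      then have "countable ?bad" using cnt by (simp add: countable_finite)
      then show ?thesis using unc by metis
    next
      case False
      have "|{f. conflict j f j' (F j')}| \<le>o |?A|" for j'
      proof -
        have "|{f. conflict j f j' (F j')}| \<le>o |UNIV :: nat set|"
          using cnt by (simp add: countable_def card_of_ordLeq[symmetric])
        moreover have "|UNIV :: nat set| \<le>o |?A|" using False unfolding infinite_iff_card_of_nat .
        ultimately show ?thesis by (rule ordLeq_transitive)
      qed
      then have "|?bad| \<le>o |?A|"
        by (intro card_of_UNION_ordLeq_infinite[OF False] ordLeq_reflexive card_of_Well_order ballI)
      then have "|?bad| <o |UNIV :: 'f set|"
        using ordLess_ordLeq_trans[OF A small] by (rule ordLeq_ordLess_trans)
      then show ?thesis using ordLess_irreflexive by metis
    qed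
    then obtain f where "f \<notin> ?bad" by blast
    then have "?P F j f" by (auto simp: underS_def)
    then show "\<exists>f. ?P F j f" by blast
  qed
  then obtain F where F: "\<And>j j'. (j', j) \<in> ?R - Id \<Longrightarrow> \<not> conflict j (F j) j' (F j')" by blast
  have "\<not> conflict j (F j) j' (F j')" if "j \<noteq> j'" for j j'
  proof -
    have "(j, j') \<in> ?R \<or> (j', j) \<in> ?R"
      using wo that FR by (simp add: order_on_defs total_on_def)
    then show ?thesis using F[of j j'] F[of j' j] sym that by blast
  qed
  then show ?thesis by blast
qed

lemma reals_inject_nat_sets: "\<exists>e :: real \<Rightarrow> nat set. inj e"
  using nat_sets_eqpoll_reals eqpoll_sym unfolding eqpoll_def
  by (metis bij_betw_imp_inj_on)

lemma uncountable_nat_bool: "uncountable (UNIV :: (nat \<Rightarrow> bool) set)"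
proof
  assume c: "countable (UNIV :: (nat \<Rightarrow> bool) set)"
  obtain e :: "real \<Rightarrow> nat set" where "inj e" using reals_inject_nat_sets by blast
  then have "inj (\<lambda>x m. m \<in> e x)" by (auto simp: inj_def fun_eq_iff)
  moreover have "countable (range (\<lambda>x m. m \<in> e x))" by (rule countable_subset[OF _ c]) simp
  ultimately have "countable (UNIV :: real set)" using countable_image_inj_eq by blast
  then show False using uncountable_UNIV_real by blast
qed

text \<open>Even bits code the set of nodes, odd bits the real.\<close>

lemma tree_real_pairs_card:
  "|UNIV :: (nat list set \<times> real) set| \<le>o |UNIV :: (nat \<Rightarrow> bool) set|"
proof -
  obtain e :: "real \<Rightarrow> nat set" where e: "inj e" using reals_inject_nat_sets by blast
  define c :: "nat list set \<times> real \<Rightarrow> nat \<Rightarrow> bool" where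
    "c = (\<lambda>(p, x) m. if even m then from_nat (m div 2) \<in> p else m div 2 \<in> e x)"
  have "inj c"
  proof (rule injI)
    fix u v assume eq: "c u = c v"
    obtain p x q y where u: "u = (p, x)" "v = (q, y)" by (metis surj_pair)
    have "\<eta> \<in> p \<longleftrightarrow> \<eta> \<in> q" for \<eta>
      using fun_cong[OF eq, of "2 * to_nat \<eta>"] by (simp add: c_def u)
    moreover have "m \<in> e x \<longleftrightarrow> m \<in> e y" for m
      using fun_cong[OF eq, of "Suc (2 * m)"] by (simp add: c_def u)
    ultimately have "p = q" "e x = e y" by blast+
    then show "u = v" using e by (simp add: u inj_eq)
  qed
  then show ?thesis using card_of_ordLeq by blast
qed

section \<open>Tree forcings with infinite splitting\<close>

text \<open>Prunes at infinitely splitting nodes only; all other nodes that survive keep their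
  successors, so that a stem is preserved.\<close>

definition thin :: "nat list set \<Rightarrow> (nat list \<Rightarrow> nat set) \<Rightarrow> nat list set" where
  "thin p Y = {\<eta> \<in> p. \<forall>\<nu> k. prefix (\<nu> @ [k]) \<eta> \<longrightarrow> infinite (succs \<nu> p) \<longrightarrow> k \<in> Y \<nu>}"

lemma thin_subset: "thin p Y \<subseteq> p"
  by (auto simp: thin_def)

lemma is_tree_Nil: "is_tree p \<Longrightarrow> [] \<in> p"
  unfolding is_tree_def using Nil_prefix by blast

lemma is_tree_thin:
  assumes "is_tree p"
  shows "is_tree (thin p Y)"
proof -
  have "[] \<in> thin p Y" using is_tree_Nil[OF assms] by (simp add: thin_def)
  moreover have "\<nu> \<in> thin p Y" if "\<eta> \<in> thin p Y" "prefix \<nu> \<eta>" for \<eta> \<nu>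
    using assms that prefix_order.trans[OF _ that(2)] unfolding is_tree_def thin_def by blast
  ultimately show ?thesis unfolding is_tree_def by blast
qed

lemma succs_thin:
  assumes "\<eta> \<in> thin p Y"
  shows "succs \<eta> (thin p Y) = (if infinite (succs \<eta> p) then succs \<eta> p \<inter> Y \<eta> else succs \<eta> p)"
  using assms by (auto simp: succs_def thin_def)

text \<open>The common features of Laver and Miller forcing behind the collapse: closure under
  pruning supplies conditions, and infinitely many splitting nodes supply \<open>n\<close> distinct
  ones in any condition.\<close>

locale splitting_tree_forcing =
  fixes T :: "nat list set \<Rightarrow> bool"
  assumes thin_closed: "T p \<Longrightarrow> (\<And>\<eta>. infinite (succs \<eta> p) \<Longrightarrow> infinite (Y \<eta>) \<and> Y \<eta> \<subseteq> succs \<eta> p) \<Longrightarrow>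
      T (thin p Y)"
    and infinitely_many_splittings: "T p \<Longrightarrow> infinite {\<eta>. infinite (succs \<eta> p)}"
begin

definition forcing :: "nat list set rel" where
  "forcing = {(q, p). T q \<and> T p \<and> q \<subseteq> p}"

lemma Field_forcing: "Field forcing = Collect T"
  by (auto simp: Field_def forcing_def)

lemma refl_forcing: "refl_on (Field forcing) forcing"
  unfolding Field_forcing by (auto simp: refl_on_def forcing_def)

lemma trans_forcing: "trans forcing"
  by (auto simp: trans_def forcing_def)

text \<open>A common extension of two chosen thinnings of the same level has \<open>n\<close>
  splitting nodes, and its successor sets there form a condition below both tuples, so the codes
  agree, against the choice of \<open>F\<close>. Hence a level determines the real, and every real
  is attained since each \<open>p\<close> has a thinning for each \<open>x\<close>.\<close>

lemma same_card_continuum_h_number: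
  assumes "0 < n"
  shows "holds_in_generic_extensions forcing (f_same_card forcing continuum (h_number n))"
proof -
  let ?\<kappa> = "h_number n"
  obtain B where "tuple_matrix n ?\<kappa> B" using h_number_tuple_matrix[OF assms] by blast
  then interpret tuple_matrix n ?\<kappa> B .
  \<comment> \<open>Padding by \<open>UNIV\<close> makes all sets infinite; \<open>thin\<close>
    consults only the infinitely splitting nodes.\<close>
  define X where "X p \<eta> = (if infinite (succs \<eta> p) then succs \<eta> p else UNIV)" for p \<eta>
  have X: "inf_sets (X p)" for p by (simp add: X_def inf_sets_def)
  have "\<forall>p. \<exists>l. \<exists>Y :: (nat \<Rightarrow> bool) \<Rightarrow> nat list \<Rightarrow> nat set. l \<in> Field ?\<kappa> \<and>
    (\<forall>f. inf_sets (Y f) \<and> Y f \<le> X p) \<and>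
    (\<forall>t. distinct t \<and> length t = n \<longrightarrow>
      (\<forall>f. \<forall>\<beta>\<in>under ?\<kappa> l. tuple_below n (B \<beta>) (tuple_of (Y f) t)) \<and>
      inj (\<lambda>f. code l (tuple_of (Y f) t)))"
    using continuum_many_codes[OF X] by (simp add: Bex_def)
  then obtain l where "\<forall>p. \<exists>Y :: (nat \<Rightarrow> bool) \<Rightarrow> nat list \<Rightarrow> nat set. l p \<in> Field ?\<kappa> \<and>
    (\<forall>f. inf_sets (Y f) \<and> Y f \<le> X p) \<and>
    (\<forall>t. distinct t \<and> length t = n \<longrightarrow>
      (\<forall>f. \<forall>\<beta>\<in>under ?\<kappa> (l p). tuple_below n (B \<beta>) (tuple_of (Y f) t)) \<and>
      inj (\<lambda>f. code (l p) (tuple_of (Y f) t)))"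
    by (rule choice[THEN exE])
  then obtain Y where Y_all: "\<forall>p. l p \<in> Field ?\<kappa> \<and>
    (\<forall>f :: nat \<Rightarrow> bool. inf_sets (Y p f) \<and> Y p f \<le> X p) \<and>
    (\<forall>t. distinct t \<and> length t = n \<longrightarrow>
      (\<forall>f. \<forall>\<beta>\<in>under ?\<kappa> (l p). tuple_below n (B \<beta>) (tuple_of (Y p f) t)) \<and>
      inj (\<lambda>f. code (l p) (tuple_of (Y p f) t)))"
    by (rule choice[THEN exE])
  have l: "l p \<in> Field ?\<kappa>" for p using Y_all by simp
  have Y: "inf_sets (Y p f)" "Y p f \<le> X p" for p f using Y_all by simp_all
  have below: "\<forall>\<beta>\<in>under ?\<kappa> (l p). tuple_below n (B \<beta>) (tuple_of (Y p f) t)"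
    and inj: "inj (\<lambda>f. code (l p) (tuple_of (Y p f) t))"
    if "distinct t" "length t = n" for p f t
    using Y_all that by simp_all
  define conflict where "conflict = (\<lambda>(p, x :: real) f (p', x' :: real) g. l p = l p' \<and>
    (\<exists>t. distinct t \<and> length t = n \<and>
      code (l p) (tuple_of (Y p f) t) = code (l p) (tuple_of (Y p' g) t)))"
  have "\<exists>F. \<forall>j j'. j \<noteq> j' \<longrightarrow> \<not> conflict j (F j) j' (F j')"
  proof (rule greedy_selection[OF tree_real_pairs_card uncountable_nat_bool])
    show "conflict j' g j f" if "conflict j f j' g" for j j' f g
    proof -
      obtain p x p' x' where j: "j = (p, x)" "j' = (p', x')" by (metis surj_pair)
      then show ?thesis using that by (auto simp: conflict_def)
    qed
    show "countable {f. conflict j f j' g}" for j j' g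
    proof -
      obtain p x p' x' where j: "j = (p, x)" "j' = (p', x')" by (metis surj_pair)
      \<comment> \<open>For fixed \<open>t\<close> at most one \<open>f\<close> has the prescribed
        code, by injectivity, and there are countably many lists \<open>t\<close>.\<close>
      let ?S = "\<lambda>t. {f. distinct t \<and> length t = n \<and>
        code (l p) (tuple_of (Y p f) t) = code (l p) (tuple_of (Y p' g) t)}"
      have "countable (?S t)" for t
      proof (cases "distinct t \<and> length t = n")
        case True
        then have "finite (?S t)"
          using finite_vimageI[OF _ inj, of "{code (l p) (tuple_of (Y p' g) t)}" t p]
          by (simp add: vimage_def)
        then show ?thesis by (rule countable_finite)
      qed (simp only: conj_assoc[symmetric], simp)
      then have "countable (\<Union>t. ?S t)" by simp
      moreover have "{f. conflict j f j' g} \<subseteq> (\<Union>t. ?S t)" by (auto simp: conflict_def j)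
      ultimately show ?thesis by (rule countable_subset[rotated])
    qed
  qed
  then obtain F where F: "\<forall>j j'. j \<noteq> j' \<longrightarrow> \<not> conflict j (F j) j' (F j')" by (elim exE)
  define q where "q p x = thin p (Y p (F (p, x)))" for p x
  have Y_succs: "infinite (Y p f \<eta>) \<and> Y p f \<eta> \<subseteq> succs \<eta> p" if "infinite (succs \<eta> p)" for p f \<eta>
    using Y(1)[of p f] le_funD[OF Y(2)[of p f], of \<eta>] that by (simp add: inf_sets_def X_def)
  have q: "T (q p x)" "q p x \<subseteq> p" if "T p" for p x
    unfolding q_def using that by (auto intro!: thin_closed dest: Y_succs subsetD[OF thin_subset])
  have q_succs: "succs \<eta> r \<subseteq> Y p (F (p, x)) \<eta>" if "r \<subseteq> q p x" "infinite (succs \<eta> r)" for r p x \<eta>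
  proof
    fix k assume "k \<in> succs \<eta> r"
    then have "\<eta> @ [k] \<in> thin p (Y p (F (p, x)))" using that(1) by (auto simp: succs_def q_def)
    moreover have "succs \<eta> r \<subseteq> succs \<eta> p"
      using that(1) thin_subset unfolding q_def succs_def by blast
    then have "infinite (succs \<eta> p)" using that(2) finite_subset by blast
    ultimately show "k \<in> Y p (F (p, x)) \<eta>" by (simp add: thin_def)
  qed
  \<comment> \<open>\<open>r\<close> sends level \<open>\<alpha>\<close> to \<open>x\<close>: it
    extends the thinning chosen for \<open>x\<close> and some tree of that level.\<close>
  let ?Q = "\<lambda>r \<alpha> x. \<exists>p. T p \<and> l p = \<alpha> \<and> r \<subseteq> q p x"
  show ?thesis
  proof (rule f_same_card_if_partial_surjection[OF refl_forcing trans_forcing wo infinite_Field,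
        where Q = ?Q])
    have "|Field ?\<kappa>| \<le>o |UNIV :: nat set set|" by (rule card_of_mono1) simp
    moreover have "|UNIV :: nat set set| =o |UNIV :: real set|"
      using nat_sets_eqpoll_reals unfolding eqpoll_iff_card_of_ordIso .
    ultimately show "|Field ?\<kappa>| \<le>o |Field continuum|"
      unfolding continuum_def Field_card_of by (rule ordLeq_ordIso_trans)
    show "?Q r \<alpha> x" if "?Q s \<alpha> x" "(r, s) \<in> forcing" for r s \<alpha> x
      using that by (auto simp: forcing_def)
    show "x = y" if r: "r \<in> Field forcing" and "?Q r \<alpha> x" "?Q r \<alpha> y" for r \<alpha> x y
    proof (rule ccontr)
      assume "x \<noteq> y"
      obtain p where p: "l p = \<alpha>" "r \<subseteq> q p x" using \<open>?Q r \<alpha> x\<close> by blast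
      obtain p' where p': "l p' = \<alpha>" "r \<subseteq> q p' y" using \<open>?Q r \<alpha> y\<close> by blast
      have "infinite {\<eta>. infinite (succs \<eta> r)}"
        using r by (intro infinitely_many_splittings) (simp add: Field_forcing)
      then obtain S where S: "finite S" "card S = n" "S \<subseteq> {\<eta>. infinite (succs \<eta> r)}"
        using infinite_arbitrarily_large by blast
      then obtain t where t: "set t = S" "distinct t" using finite_distinct_list by blast
      then have len: "length t = n" using S(2) distinct_card by fastforce
      define z where "z = tuple_of (X r) t"
      have z: "inf_sets z" unfolding z_def using X by (rule inf_sets_tuple_of)
      have le: "tuple_le n z (tuple_of (Y p (F (p, x))) t)" if "r \<subseteq> q p x" for p x
        unfolding tuple_le_def
      proof (intro allI impI)
        fix i assume "i < n"
        then have "t ! i \<in> S" using t(1) len by auto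
        then have inf: "infinite (succs (t ! i) r)" using S(3) by blast
        have "z i \<subseteq> tuple_of (Y p (F (p, x))) t i"
          using q_succs[OF that inf] inf by (simp add: z_def tuple_of_def X_def)
        then show "finite (z i - tuple_of (Y p (F (p, x))) t i)"
          by (simp add: Diff_eq_empty_iff[THEN iffD2])
      qed
      have "code (l p) z = code (l p) (tuple_of (Y p (F (p, x))) t)"
        by (rule code_eq_if_le[OF below[OF t(2) len] z le[OF p(2)]])
      moreover have "code (l p') z = code (l p') (tuple_of (Y p' (F (p', y))) t)"
        by (rule code_eq_if_le[OF below[OF t(2) len] z le[OF p'(2)]])
      ultimately have "conflict (p, x) (F (p, x)) (p', y) (F (p', y))"
        using p(1) p'(1) t(2) len by (auto simp: conflict_def)
      then show False using F \<open>x \<noteq> y\<close> by simp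
    qed
    show "\<exists>s \<alpha>. (s, p) \<in> forcing \<and> \<alpha> \<in> Field ?\<kappa> \<and> ?Q s \<alpha> x" if "p \<in> Field forcing" for p x
    proof -
      have p: "T p" using that by (simp add: Field_forcing)
      then have "(q p x, p) \<in> forcing \<and> l p \<in> Field ?\<kappa> \<and> ?Q (q p x) (l p) x"
        using q l by (auto simp: forcing_def)
      then show ?thesis by (intro exI)
    qed
  qed
qed

end

section \<open>Laver and Miller forcing as instances\<close>

text \<open>Nodes strictly below the stem have a single successor, so pruning leaves the stem in
  place. The immediate successors of the stem are infinitely many splitting nodes.\<close>

lemma splitting_tree_forcing_laver: "splitting_tree_forcing laver_tree"
proof
  fix p assume p: "laver_tree p"
  then obtain s where tree: "is_tree p" and s: "is_stem p s"
    and split: "\<And>\<eta>. \<eta> \<in> p \<Longrightarrow> prefix s \<eta> \<Longrightarrow> infinite (succs \<eta> p)"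
    unfolding laver_tree_def by blast
  have sp: "s \<in> p" using s by (simp add: is_stem_def)
  {
    fix Y assume Y: "\<And>\<eta>. infinite (succs \<eta> p) \<Longrightarrow> infinite (Y \<eta>) \<and> Y \<eta> \<subseteq> succs \<eta> p"
    let ?q = "thin p Y"
    have tq: "is_tree ?q" using tree by (rule is_tree_thin)
    have fin: "card (succs \<nu> p) = 1" if "strict_prefix \<nu> s" for \<nu>
      using s that by (simp add: is_stem_def)
    have sq: "s \<in> ?q"
    proof -
      have "finite (succs \<nu> p)" if "prefix (\<nu> @ [k]) s" for \<nu> k
      proof -
        have "strict_prefix \<nu> s" using that by (rule prefix_snocD)
        then show ?thesis using fin[of \<nu>] card.infinite by fastforce
      qed
      then show ?thesis using sp by (auto simp: thin_def)
    qed
    have inf: "infinite (succs \<eta> ?q)" if "\<eta> \<in> ?q" "prefix s \<eta>" for \<eta>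
    proof -
      have "infinite (succs \<eta> p)" using split that thin_subset by blast
      then show ?thesis using succs_thin[OF that(1)] Y by (simp add: Int_absorb1)
    qed
    have "card (succs \<nu> ?q) = 1" if "strict_prefix \<nu> s" for \<nu>
    proof -
      have "\<nu> \<in> ?q" using tq sq that unfolding is_tree_def strict_prefix_def by blast
      moreover have "finite (succs \<nu> p)" using fin[OF that] card.infinite by fastforce
      ultimately show ?thesis using fin[OF that] by (simp add: succs_thin)
    qed
    then have "is_stem ?q s" using sq inf by (simp add: is_stem_def)
    then show "laver_tree ?q" using tq inf unfolding laver_tree_def by blast
  }
  have "infinite ((\<lambda>k. s @ [k]) ` succs s p)"
    using split[OF sp] by (simp add: finite_image_iff inj_on_def)
  moreover have "(\<lambda>k. s @ [k]) ` succs s p \<subseteq> {\<eta>. infinite (succs \<eta> p)}"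
  proof
    fix \<eta> assume "\<eta> \<in> (\<lambda>k. s @ [k]) ` succs s p"
    then have "\<eta> \<in> p" "prefix s \<eta>" by (auto simp: succs_def)
    then show "\<eta> \<in> {\<eta>. infinite (succs \<eta> p)}" using split by blast
  qed
  ultimately show "infinite {\<eta>. infinite (succs \<eta> p)}" using finite_subset by blast
qed

text \<open>Above a surviving node, the shortest splitting extension survives too. Splitting nodes
  of arbitrary length exist, so there are infinitely many.\<close>

lemma splitting_tree_forcing_miller: "splitting_tree_forcing superperfect_tree"
proof
  fix p assume p: "superperfect_tree p"
  then have tree: "is_tree p"
    and split: "\<And>\<eta>. \<eta> \<in> p \<Longrightarrow> \<exists>\<nu>\<in>p. prefix \<eta> \<nu> \<and> infinite (succs \<nu> p)"
    unfolding superperfect_tree_def by blast+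
  {
    fix Y assume Y: "\<And>\<eta>. infinite (succs \<eta> p) \<Longrightarrow> infinite (Y \<eta>) \<and> Y \<eta> \<subseteq> succs \<eta> p"
    let ?q = "thin p Y"
    have "\<exists>\<nu>\<in>?q. prefix \<eta> \<nu> \<and> infinite (succs \<nu> ?q)" if \<eta>: "\<eta> \<in> ?q" for \<eta>
    proof -
      let ?N = "\<lambda>\<nu>. \<nu> \<in> p \<and> prefix \<eta> \<nu> \<and> infinite (succs \<nu> p)"
      have "\<exists>\<nu>. ?N \<nu>" using split \<eta> thin_subset by blast
      \<comment> \<open>By minimality of its length, no node from \<open>\<eta>\<close> up to but
        excluding \<open>\<nu>\<close> splits infinitely, so nothing is pruned on the way.\<close>
      then obtain \<nu> where \<nu>: "?N \<nu>" and least: "\<And>\<mu>. ?N \<mu> \<Longrightarrow> length \<nu> \<le> length \<mu>"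
        using ex_has_least_nat[of ?N _ length] by metis
      have "k \<in> Y \<mu>" if \<mu>: "prefix (\<mu> @ [k]) \<nu>" "infinite (succs \<mu> p)" for \<mu> k
      proof (cases "prefix (\<mu> @ [k]) \<eta>")
        case True
        then show ?thesis using \<eta> \<mu>(2) by (simp add: thin_def)
      next
        case False
        then have "prefix \<eta> (\<mu> @ [k])" using prefix_same_cases[OF \<mu>(1)] \<nu> by blast
        then have "prefix \<eta> \<mu>" using False by auto
        moreover have "prefix \<mu> \<nu>" using append_prefixD[OF \<mu>(1)] .
        then have "\<mu> \<in> p" using \<nu> tree unfolding is_tree_def by blast
        ultimately have "length \<nu> \<le> length \<mu>" using least \<mu>(2) by blast
        then show ?thesis using prefix_length_le[OF \<mu>(1)] by simp
      qed
      then have \<nu>q: "\<nu> \<in> ?q" using \<nu> by (simp add: thin_def)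
      have "infinite (succs \<nu> ?q)" using succs_thin[OF \<nu>q] \<nu> Y by (simp add: Int_absorb1)
      then show ?thesis using \<nu>q \<nu> by blast
    qed
    then show "superperfect_tree ?q"
      using is_tree_thin[OF tree] unfolding superperfect_tree_def by blast
  }
  show "infinite {\<eta>. infinite (succs \<eta> p)}" (is "infinite ?S")
  proof
    assume fin: "finite ?S"
    have "\<exists>\<eta>\<in>?S. m \<le> length \<eta>" for m
    proof (induction m)
      case 0
      then show ?case using split[OF is_tree_Nil[OF tree]] by blast
    next
      case (Suc m)
      then obtain \<eta> where \<eta>: "infinite (succs \<eta> p)" "m \<le> length \<eta>" by blast
      then obtain k where "\<eta> @ [k] \<in> p" using infinite_imp_nonempty by (auto simp: succs_def)
      then obtain \<nu> where "prefix (\<eta> @ [k]) \<nu>" "infinite (succs \<nu> p)" using split by blast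
      then show ?case using \<eta>(2) prefix_length_le by fastforce
    qed
    then obtain \<eta> where "\<eta> \<in> ?S" "Suc (Max (length ` ?S)) \<le> length \<eta>" by blast
    moreover have "length \<eta> \<le> Max (length ` ?S)" using fin \<open>\<eta> \<in> ?S\<close> by (intro Max_ge) auto
    ultimately show False by simp
  qed
qed

theorem theorem2p2:
  fixes n :: nat
  assumes "0 < n"
  shows "holds_in_generic_extensions laver_forcing
           (f_same_card laver_forcing continuum (h_number n)) \<and>
         holds_in_generic_extensions miller_forcing
           (f_same_card miller_forcing continuum (h_number n))"
proof
  have "splitting_tree_forcing.forcing laver_tree = laver_forcing"
    by (simp add: splitting_tree_forcing.forcing_def[OF splitting_tree_forcing_laver]
        laver_forcing_def)
  then show "holds_in_generic_extensions laver_forcing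
      (f_same_card laver_forcing continuum (h_number n))"
    using splitting_tree_forcing.same_card_continuum_h_number[OF splitting_tree_forcing_laver assms]
    by simp
  have "splitting_tree_forcing.forcing superperfect_tree = miller_forcing"
    by (simp add: splitting_tree_forcing.forcing_def[OF splitting_tree_forcing_miller]
        miller_forcing_def)
  then show "holds_in_generic_extensions miller_forcing
      (f_same_card miller_forcing continuum (h_number n))"
    using splitting_tree_forcing.same_card_continuum_h_number[OF splitting_tree_forcing_miller assms]
    by simp
qed

end
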